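(* Let $G=(V,E)$ be a connected locally finite graph with symmetric positive edge weights $\omega_{xy}=\omega_{yx}>0$ ($xy\in E$) and measure $\mu:V\to(0,\infty)$ satisfying $\mu(x)\ge\mu_{\min}$ for all $x\in V$, for some constant $\mu_{\min}>0$. Assume the potential $a:V\to\mathbb{R}$ satisfies: $(A_1)$ $\inf_{x\in V}a(x)\ge a_0$ for some constant $a_0\in(-1,0)$; $(A_2')$ there exists $M_0>0$ such that $1/a(x)\in L^1(V\setminus D_{M_0})$, where $D_{M_0}=\{x\in V: a(x)\le M_0\}$, and the volume $\sum_{x\in D_{M_0}}\mu(x)$ of $D_{M_0}$ is finite. Then the equation $-\Delta u+a(x)u=u\log u^2$ in $V$ admits a ground state solution.
   Context: A graph is locally finite if every vertex has finitely many neighbours; write $y\sim x$ if $xy\in E$. For $u,v:V\to\mathbb{R}$: $\int_V u\,d\mu=\sum_{x\in V}\mu(x)u(x)$ (and $L^1$ is with respect to $\mu$); $\Delta u(x)=\frac1{\mu(x)}\sum_{y\sim x}\omega_{xy}(u(y)-u(x))$; $\Gamma(u,v)(x)=\frac1{2\mu(x)}\sum_{y\sim x}\omega_{xy}(u(y)-u(x))(v(y)-v(x))$; $|\nabla u|^2=\Gamma(u,u)$. The convention $0\log 0=0$ is used, so that $u\log u^2=u^2\log u^2=0$ where $u=0$. $C_c(V)$ is the set of functions with finite support, and $H^1(V)$ is the completion of $C_c(V)$ under $\|u\|_{H^1(V)}=\left(\int_V(|\nabla u|^2+u^2)\,d\mu\right)^{1/2}$ (regarded as a space of functions on $V$). Put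 $\mathcal H=\{u\in H^1(V):\int_V a(x)u^2\,d\mu<+\infty\}$ with norm $\|u\|_{\mathcal H}=\left(\int_V(|\nabla u|^2+(a(x)+1)u^2)\,d\mu\right)^{1/2}$. For $u\in\mathcal H$ let $J(u)=\frac12\|u\|_{\mathcal H}^2-\frac12\int_V u^2\log u^2\,d\mu$ (under the hypotheses of the theorem $J$ is finite and $C^1$ on $\mathcal H$). A weak solution of the equation (equivalently, a critical point of $J$) is a $u\in\mathcal H$ with $\int_V(\Gamma(u,v)+a(x)uv)\,d\mu=\int_V uv\log u^2\,d\mu$ for all $v\in\mathcal H$. A ground state solution is a weak solution $u\neq0$ whose energy $J(u)$ is the minimum of $J$ over all nonzero weak solutions. *)

theory Defs
  imports "HOL-Analysis.Analysis"
begin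

text \<open>
  A graph has the whole (arbitrary) type \<open>'v\<close> as vertex set.  Its undirected edges are given by a
  symmetric relation \<open>E\<close>, so that \<open>E `` {x}\<close> is the set of neighbours of \<open>x\<close>.  Loops need not be
  excluded, since they contribute nothing to \<open>\<Gamma>\<close>.  Weights \<open>\<omega> x y\<close> are only ever used for
  \<open>(x, y) \<in> E\<close>.
\<close>

definition locally_finite_graph :: "('v \<times> 'v) set \<Rightarrow> bool" where
  "locally_finite_graph E \<longleftrightarrow> sym E \<and> (\<forall>x. finite (E `` {x}))"

definition connected_graph :: "('v \<times> 'v) set \<Rightarrow> bool" where
  "connected_graph E \<longleftrightarrow> (\<forall>x y. (x, y) \<in> E\<^sup>*)"

text \<open>The measure giving mass \<open>\<mu> x\<close> to each vertex \<open>x\<close>; all subsets are measurable.\<close>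

definition vertex_measure :: "('v \<Rightarrow> real) \<Rightarrow> 'v measure" where
  "vertex_measure \<mu> = point_measure UNIV (\<lambda>x. ennreal (\<mu> x))"

lemma integrable_vertex_measure_iff:
  fixes u :: "'v \<Rightarrow> real"
  assumes "\<And>x. 0 < \<mu> x"
  shows "integrable (vertex_measure \<mu>) u \<longleftrightarrow> (\<lambda>x. \<mu> x * u x) summable_on UNIV"
proof -
  have "integrable (vertex_measure \<mu>) u \<longleftrightarrow> integrable (count_space UNIV) (\<lambda>x. \<mu> x *\<^sub>R u x)"
    unfolding vertex_measure_def point_measure_def
    by (rule integrable_density) (simp_all add: assms less_imp_le)
  also have "\<dots> \<longleftrightarrow> Infinite_Set_Sum.abs_summable_on (\<lambda>x. \<mu> x * u x) UNIV"
    by (simp add: Infinite_Set_Sum.abs_summable_on_def)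
  also have "\<dots> \<longleftrightarrow> (\<lambda>x. norm (\<mu> x * u x)) summable_on UNIV"
    by (rule abs_summable_equivalent[symmetric])
  also have "\<dots> \<longleftrightarrow> (\<lambda>x. \<mu> x * u x) summable_on UNIV"
    by (rule summable_on_iff_abs_summable_on_real[symmetric])
  finally show ?thesis .
qed

lemma integral_vertex_measure:
  fixes u :: "'v \<Rightarrow> real"
  assumes "\<And>x. 0 < \<mu> x"
  shows "integral\<^sup>L (vertex_measure \<mu>) u = (\<Sum>\<^sub>\<infinity>x. \<mu> x * u x)"
proof (cases "integrable (vertex_measure \<mu>) u")
  case True
  then have "(\<lambda>x. norm (\<mu> x * u x)) summable_on UNIV"
    unfolding integrable_vertex_measure_iff[OF assms]
    by (rule summable_on_iff_abs_summable_on_real[THEN iffD1])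
  then have abs: "Infinite_Set_Sum.abs_summable_on (\<lambda>x. \<mu> x * u x) UNIV"
    by (rule abs_summable_equivalent[THEN iffD1])
  have "integral\<^sup>L (vertex_measure \<mu>) u = integral\<^sup>L (count_space UNIV) (\<lambda>x. \<mu> x *\<^sub>R u x)"
    unfolding vertex_measure_def point_measure_def
    by (rule integral_density) (simp_all add: assms less_imp_le)
  also have "\<dots> = infsetsum (\<lambda>x. \<mu> x * u x) UNIV"
    by (simp add: infsetsum_def)
  also have "\<dots> = (\<Sum>\<^sub>\<infinity>x. \<mu> x * u x)"
    using infsetsum_infsum[OF abs] .
  finally show ?thesis .
next
  case False
  then have "\<not> (\<lambda>x. \<mu> x * u x) summable_on UNIV"
    unfolding integrable_vertex_measure_iff[OF assms] .
  with False show ?thesis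
    by (simp add: not_integrable_integral_eq infsum_not_exists del: summable_on_cmult_right')
qed

definition Gam :: "('v \<times> 'v) set \<Rightarrow> ('v \<Rightarrow> 'v \<Rightarrow> real) \<Rightarrow> ('v \<Rightarrow> real)
    \<Rightarrow> ('v \<Rightarrow> real) \<Rightarrow> ('v \<Rightarrow> real) \<Rightarrow> 'v \<Rightarrow> real" where
  "Gam E \<omega> \<mu> u v x = 1 / (2 * \<mu> x) * (\<Sum>y\<in>E `` {x}. \<omega> x y * (u y - u x) * (v y - v x))"

definition grad_sq :: "('v \<times> 'v) set \<Rightarrow> ('v \<Rightarrow> 'v \<Rightarrow> real) \<Rightarrow> ('v \<Rightarrow> real)
    \<Rightarrow> ('v \<Rightarrow> real) \<Rightarrow> 'v \<Rightarrow> real" where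
  "grad_sq E \<omega> \<mu> u x = Gam E \<omega> \<mu> u u x"

definition Cc :: "('v \<Rightarrow> real) set" where
  "Cc = {u. finite {x. u x \<noteq> 0}}"

definition H1_norm :: "('v \<times> 'v) set \<Rightarrow> ('v \<Rightarrow> 'v \<Rightarrow> real) \<Rightarrow> ('v \<Rightarrow> real)
    \<Rightarrow> ('v \<Rightarrow> real) \<Rightarrow> real" where
  "H1_norm E \<omega> \<mu> u = sqrt (LINT x|vertex_measure \<mu>. grad_sq E \<omega> \<mu> u x + (u x)\<^sup>2)"

text \<open>
  The functions of finite \<open>H1_norm\<close> form a Hilbert space, so the completion of \<open>Cc\<close> is realised as
  the closure of \<open>Cc\<close> in it.  The integrability requirement matters: the Bochner
  integral of a non-integrable function is 0.
\<close>

definition H1 :: "('v \<times> 'v) set \<Rightarrow> ('v \<Rightarrow> 'v \<Rightarrow> real) \<Rightarrow> ('v \<Rightarrow> real) \<Rightarrow> ('v \<Rightarrow> real) set" where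
  "H1 E \<omega> \<mu> = {u. integrable (vertex_measure \<mu>) (\<lambda>x. grad_sq E \<omega> \<mu> u x + (u x)\<^sup>2) \<and>
     (\<exists>\<phi>. (\<forall>n. \<phi> n \<in> Cc) \<and> (\<lambda>n. H1_norm E \<omega> \<mu> (\<lambda>x. \<phi> n x - u x)) \<longlonglongrightarrow> 0)}"

text \<open>
  For \<open>a\<close> bounded below and \<open>u \<in> H1\<close> the negative part of \<open>a u\<^sup>2\<close> is integrable, so
  \<open>\<integral> a u\<^sup>2 d\<mu> < \<infinity>\<close> is integrability of \<open>a u\<^sup>2\<close>.
\<close>

definition Hsp :: "('v \<times> 'v) set \<Rightarrow> ('v \<Rightarrow> 'v \<Rightarrow> real) \<Rightarrow> ('v \<Rightarrow> real) \<Rightarrow> ('v \<Rightarrow> real)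
    \<Rightarrow> ('v \<Rightarrow> real) set" where
  "Hsp E \<omega> \<mu> a = {u \<in> H1 E \<omega> \<mu>. integrable (vertex_measure \<mu>) (\<lambda>x. a x * (u x)\<^sup>2)}"

definition Hsp_norm :: "('v \<times> 'v) set \<Rightarrow> ('v \<Rightarrow> 'v \<Rightarrow> real) \<Rightarrow> ('v \<Rightarrow> real) \<Rightarrow> ('v \<Rightarrow> real)
    \<Rightarrow> ('v \<Rightarrow> real) \<Rightarrow> real" where
  "Hsp_norm E \<omega> \<mu> a u =
     sqrt (LINT x|vertex_measure \<mu>. grad_sq E \<omega> \<mu> u x + (a x + 1) * (u x)\<^sup>2)"

text \<open>Since \<open>ln 0 = 0\<close>, the terms \<open>u\<^sup>2 log u\<^sup>2\<close> and \<open>u log u\<^sup>2\<close> vanish where \<open>u = 0\<close>.\<close>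

definition J :: "('v \<times> 'v) set \<Rightarrow> ('v \<Rightarrow> 'v \<Rightarrow> real) \<Rightarrow> ('v \<Rightarrow> real) \<Rightarrow> ('v \<Rightarrow> real)
    \<Rightarrow> ('v \<Rightarrow> real) \<Rightarrow> real" where
  "J E \<omega> \<mu> a u = 1 / 2 * (Hsp_norm E \<omega> \<mu> a u)\<^sup>2
     - 1 / 2 * (LINT x|vertex_measure \<mu>. (u x)\<^sup>2 * ln ((u x)\<^sup>2))"

text \<open>
  Weak form of \<open>- \<Delta>u + a u = u log u\<^sup>2\<close>, where
  \<open>\<Delta>u(x) = (1 / \<mu> x) * (\<Sum>y\<in>E `` {x}. \<omega> x y * (u y - u x))\<close>.
\<close>

definition weak_solution :: "('v \<times> 'v) set \<Rightarrow> ('v \<Rightarrow> 'v \<Rightarrow> real) \<Rightarrow> ('v \<Rightarrow> real)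
    \<Rightarrow> ('v \<Rightarrow> real) \<Rightarrow> ('v \<Rightarrow> real) \<Rightarrow> bool" where
  "weak_solution E \<omega> \<mu> a u \<longleftrightarrow> u \<in> Hsp E \<omega> \<mu> a \<and>
     (\<forall>v \<in> Hsp E \<omega> \<mu> a.
        (LINT x|vertex_measure \<mu>. Gam E \<omega> \<mu> u v x + a x * u x * v x)
        = (LINT x|vertex_measure \<mu>. u x * v x * ln ((u x)\<^sup>2)))"

definition ground_state_solution :: "('v \<times> 'v) set \<Rightarrow> ('v \<Rightarrow> 'v \<Rightarrow> real) \<Rightarrow> ('v \<Rightarrow> real)
    \<Rightarrow> ('v \<Rightarrow> real) \<Rightarrow> ('v \<Rightarrow> real) \<Rightarrow> bool" where
  "ground_state_solution E \<omega> \<mu> a u \<longleftrightarrow>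
     weak_solution E \<omega> \<mu> a u \<and> u \<noteq> (\<lambda>x. 0) \<and>
     (\<forall>w. weak_solution E \<omega> \<mu> a w \<and> w \<noteq> (\<lambda>x. 0) \<longrightarrow> J E \<omega> \<mu> a u \<le> J E \<omega> \<mu> a w)"

end

theory Submission
  imports Defs "HOL-Complex_Analysis.Great_Picard" "HOL-Real_Asymp.Real_Asymp"
begin

text \<open>
  Write \<open>b = a + 1\<close>, so that \<open>b\<close> is bounded below by a positive constant, and
  \<open>2 J(u) = energy u - entropy u\<close> with \<open>energy u = \<integral> (|\<nabla>u|\<^sup>2 + b u\<^sup>2) d\<mu>\<close> and
  \<open>entropy u = \<integral> u\<^sup>2 log u\<^sup>2 d\<mu>\<close>.  Let \<open>mass u = \<integral> u\<^sup>2 d\<mu>\<close>.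

  The logarithm turns scaling into a shift: for \<open>mass u = 1\<close> one has
  \<open>2 J(t u) = t\<^sup>2 (2 J(u) - log t\<^sup>2)\<close>.  So the unit sphere of \<open>L\<^sup>2\<close> can
  replace the Nehari manifold: if \<open>level\<close> denotes the infimum of \<open>2 J\<close> on the part of this sphere in
  \<open>Hsp\<close>, every \<open>u\<close> in \<open>Hsp\<close> satisfies the logarithmic Sobolev inequality
  \<open>level * mass u \<le> 2 J(u) + mass u * log (mass u)\<close> (\<open>level_le\<close>).  Testing the equation with the solution
  itself shows \<open>2 J(w) = mass w\<close> for every weak solution \<open>w\<close> (\<open>nehari\<close>), so the inequality forces
  \<open>mass w \<ge> exp (level - 1)\<close> if \<open>w \<noteq> 0\<close>.  Conversely, a minimiser \<open>v\<close> on the sphere has equality, so the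
  difference of the two sides is minimal along each line through \<open>v\<close>; its derivative gives the
  equation with an extra multiple \<open>level - 1\<close> of \<open>v\<close> on the right (\<open>euler_lagrange\<close>), and multiplying \<open>v\<close>
  by \<open>exp ((level - 1) / 2)\<close> absorbs this multiple into the logarithm.  The result is a weak solution
  with the smallest admissible mass, that is, a ground state.

  It remains to find a minimiser on the sphere.  The hypotheses on \<open>a\<close> imply
  \<open>1 / b \<in> L\<^sup>1\<close>.  With \<open>\<bar>u\<bar> \<le> \<epsilon>/2 b u\<^sup>2 + 1 / (2 \<epsilon> b)\<close> this makes functions of finite energy
  integrable, and makes pointwise convergent sequences of bounded energy converge in \<open>L\<^sup>1\<close>
  (\<open>L1_convergence\<close>).  As \<open>\<mu>\<close> is bounded below, functions on the unit sphere are uniformly bounded, and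
  \<open>t\<^sup>2 log t\<^sup>2\<close> is Lipschitz on bounded sets, so \<open>mass\<close> and \<open>entropy\<close> pass to the limit.  There are
  countably many vertices, because \<open>1 / b\<close> is positive and summable; hence a minimising sequence has a
  pointwise convergent subsequence.  For its limit \<open>v\<close> the parallelogram identity, combined with the
  logarithmic Sobolev inequality at the midpoints, improves the convergence to convergence in energy
  (\<open>minimiser_exists\<close>).  This is what places \<open>v\<close> in the closure of the finitely supported functions.
\<close>

section \<open>The function \<open>t\<^sup>2 log t\<^sup>2\<close>\<close>

definition sqlog :: "real \<Rightarrow> real" where
  "sqlog t = t\<^sup>2 * ln (t\<^sup>2)"

definition sqlog_deriv :: "real \<Rightarrow> real" where
  "sqlog_deriv t = 2 * (t * ln (t\<^sup>2)) + 2 * t"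

lemma sqlog_0 [simp]: "sqlog 0 = 0"
  by (simp add: sqlog_def)

lemma tendsto_mult_ln_square_0: "((\<lambda>t::real. t * ln (t\<^sup>2)) \<longlongrightarrow> 0) (at 0)"
proof -
  have "((\<lambda>t::real. t * ln (t\<^sup>2)) \<longlongrightarrow> 0) (at_right 0)" by real_asymp
  moreover have "((\<lambda>t::real. t * ln (t\<^sup>2)) \<longlongrightarrow> 0) (at_left 0)" by real_asymp
  ultimately show ?thesis by (simp add: filterlim_split_at)
qed

lemma sqlog_has_derivative: "(sqlog has_real_derivative sqlog_deriv t) (at t)"
proof (cases "t = 0")
  case True
  have "((\<lambda>s. (sqlog s - sqlog 0) / (s - 0)) \<longlongrightarrow> 0) (at 0)"
    by (rule Lim_transform_eventually[OF tendsto_mult_ln_square_0])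
      (auto simp: eventually_at_filter sqlog_def power2_eq_square)
  with True show ?thesis
    by (simp add: has_field_derivative_iff sqlog_deriv_def)
next
  case False
  then have "((\<lambda>t::real. t\<^sup>2 * ln (t\<^sup>2)) has_real_derivative sqlog_deriv t) (at t)"
    by (auto intro!: derivative_eq_intros
        simp: sqlog_deriv_def field_simps power2_eq_square zero_less_mult_iff)
  then show ?thesis
    by (simp add: sqlog_def[abs_def])
qed

lemma isCont_sqlog_deriv: "isCont sqlog_deriv t"
proof (cases "t = 0")
  case True
  have "((\<lambda>s::real. 2 * (s * ln (s\<^sup>2)) + 2 * s) \<longlongrightarrow> 2 * 0 + 2 * 0) (at 0)"
    by (intro tendsto_intros tendsto_mult_ln_square_0)
  with True show ?thesis
    by (simp add: isCont_def sqlog_deriv_def[abs_def])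
next
  case False
  then show ?thesis
    unfolding sqlog_deriv_def by (intro continuous_intros) auto
qed

lemma sqlog_deriv_bounded: "\<exists>C. \<forall>t. \<bar>t\<bar> \<le> R \<longrightarrow> \<bar>sqlog_deriv t\<bar> \<le> C"
proof -
  have "compact (sqlog_deriv ` {-R..R})"
    by (intro compact_continuous_image continuous_at_imp_continuous_on) (auto simp: isCont_sqlog_deriv)
  from compact_imp_bounded[OF this] obtain C where C: "\<forall>y\<in>sqlog_deriv ` {-R..R}. norm y \<le> C"
    unfolding bounded_iff by metis
  then show ?thesis
    by (intro exI[of _ C]) (auto simp: abs_le_iff)
qed

text \<open>
  Although the logarithm is singular at 0, the derivative \<open>2 t log t\<^sup>2 + 2 t\<close> extends continuously by 0,
  so the mean value theorem applies on all of \<open>[-R, R]\<close>.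
\<close>

lemma sqlog_lipschitz:
  "\<exists>C. \<forall>s t. \<bar>s\<bar> \<le> R \<longrightarrow> \<bar>t\<bar> \<le> R \<longrightarrow> \<bar>sqlog s - sqlog t\<bar> \<le> C * \<bar>s - t\<bar>"
proof -
  obtain C where C: "\<And>t. \<bar>t\<bar> \<le> R \<Longrightarrow> \<bar>sqlog_deriv t\<bar> \<le> C"
    using sqlog_deriv_bounded[of R] by blast
  have "\<bar>sqlog s - sqlog t\<bar> \<le> C * \<bar>s - t\<bar>" if "\<bar>s\<bar> \<le> R" "\<bar>t\<bar> \<le> R" for s t
  proof -
    have "norm (sqlog s - sqlog t) \<le> C * norm (s - t)"
    proof (rule field_differentiable_bound)
      show "(sqlog has_field_derivative sqlog_deriv z) (at z within {-R..R})" for z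
        by (rule has_field_derivative_at_within) (rule sqlog_has_derivative)
      show "norm (sqlog_deriv z) \<le> C" if "z \<in> {-R..R}" for z
        using C[of z] that by (auto simp: abs_le_iff)
    qed (use that in \<open>auto simp: abs_le_iff\<close>)
    then show ?thesis by simp
  qed
  then show ?thesis by blast
qed

lemma square_lipschitz:
  fixes s t R :: real
  assumes "\<bar>s\<bar> \<le> R" "\<bar>t\<bar> \<le> R"
  shows "\<bar>s\<^sup>2 - t\<^sup>2\<bar> \<le> (2 * R) * \<bar>s - t\<bar>"
proof -
  have "\<bar>s\<^sup>2 - t\<^sup>2\<bar> = \<bar>s + t\<bar> * \<bar>s - t\<bar>"
    by (simp add: power2_eq_square square_diff_square_factored flip: abs_mult)
  also have "\<dots> \<le> (2 * R) * \<bar>s - t\<bar>"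
    using assms by (intro mult_right_mono) auto
  finally show ?thesis .
qed

section \<open>Fatou's lemma for real integrals\<close>

text \<open>
  A form in which the bounds \<open>c n\<close> may vary and converge, so that it gives lower semicontinuity as well
  as integrability of the limit.
\<close>

lemma integrable_Fatou:
  fixes f :: "nat \<Rightarrow> 'a \<Rightarrow> real"
  assumes int: "\<And>n. integrable M (f n)" and pos: "\<And>n x. 0 \<le> f n x"
    and lim: "\<And>x. (\<lambda>n. f n x) \<longlonglongrightarrow> g x"
    and le: "\<And>n. integral\<^sup>L M (f n) \<le> c n" and c: "c \<longlonglongrightarrow> l"
  shows "integrable M g" "integral\<^sup>L M g \<le> l"
proof -
  have gpos: "0 \<le> g x" for x
    using lim pos by (meson LIMSEQ_le_const)
  have meas: "g \<in> borel_measurable M"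
    by (rule borel_measurable_LIMSEQ_real[of M f]) (use int lim in auto)
  have "0 \<le> integral\<^sup>L M (f n)" for n
    using pos by simp
  then have "0 \<le> c n" for n
    using le order_trans by blast
  then have lpos: "0 \<le> l"
    using c by (meson LIMSEQ_le_const)
  have "(\<integral>\<^sup>+x. ennreal (g x) \<partial>M) = (\<integral>\<^sup>+x. liminf (\<lambda>n. ennreal (f n x)) \<partial>M)"
    by (intro nn_integral_cong lim_imp_Liminf[symmetric] tendsto_ennrealI lim) simp
  also have "\<dots> \<le> liminf (\<lambda>n. \<integral>\<^sup>+x. ennreal (f n x) \<partial>M)"
    using int by (intro nn_integral_liminf) auto
  also have "\<dots> = liminf (\<lambda>n. ennreal (integral\<^sup>L M (f n)))"
    using int pos by (simp add: nn_integral_eq_integral)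
  also have "\<dots> \<le> liminf (\<lambda>n. ennreal (c n))"
    by (intro Liminf_mono) (simp add: le ennreal_leI)
  also have "\<dots> = ennreal l"
    by (intro lim_imp_Liminf tendsto_ennrealI c) simp
  finally have le_l: "(\<integral>\<^sup>+x. ennreal (g x) \<partial>M) \<le> ennreal l" .
  show 1: "integrable M g"
    using le_l gpos meas by (auto simp: integrable_iff_bounded order_le_less_trans)
  show "integral\<^sup>L M g \<le> l"
    using le_l 1 gpos lpos by (simp add: nn_integral_eq_integral)
qed

section \<open>Energy densities\<close>

text \<open>
  The integrand of the polarised form of \<open>\<integral> (|\<nabla>u|\<^sup>2 + c u\<^sup>2) d\<mu>\<close>.  The weight \<open>c = 1\<close> gives the norm of
  \<open>H1\<close>, and \<open>c = a + 1\<close> that of \<open>Hsp\<close>.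
\<close>

definition energy_density ::
  "('v \<times> 'v) set \<Rightarrow> ('v \<Rightarrow> 'v \<Rightarrow> real) \<Rightarrow> ('v \<Rightarrow> real) \<Rightarrow> ('v \<Rightarrow> real)
    \<Rightarrow> ('v \<Rightarrow> real) \<Rightarrow> ('v \<Rightarrow> real) \<Rightarrow> 'v \<Rightarrow> real" where
  "energy_density E \<omega> \<mu> c u v x = Gam E \<omega> \<mu> u v x + c x * u x * v x"

lemma energy_density_0 [simp]: "energy_density E \<omega> \<mu> c (\<lambda>_. 0) v = (\<lambda>_. 0)"
  by (simp add: energy_density_def Gam_def fun_eq_iff)

lemma energy_density_add_scaled:
  "energy_density E \<omega> \<mu> c (\<lambda>x. u x + s * v x) (\<lambda>x. u x + s * v x) x =
    energy_density E \<omega> \<mu> c u u x + 2 * s * energy_density E \<omega> \<mu> c u v x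
      + s\<^sup>2 * energy_density E \<omega> \<mu> c v v x"
proof -
  have "(\<Sum>y\<in>E `` {x}. \<omega> x y * ((u y + s * v y) - (u x + s * v x)) * ((u y + s * v y) - (u x + s * v x)))
     = (\<Sum>y\<in>E `` {x}. \<omega> x y * (u y - u x) * (u y - u x)
         + 2 * s * (\<omega> x y * (u y - u x) * (v y - v x)) + s\<^sup>2 * (\<omega> x y * (v y - v x) * (v y - v x)))"
    by (intro sum.cong) (auto simp: algebra_simps power2_eq_square)
  also have "\<dots> = (\<Sum>y\<in>E `` {x}. \<omega> x y * (u y - u x) * (u y - u x))
         + 2 * s * (\<Sum>y\<in>E `` {x}. \<omega> x y * (u y - u x) * (v y - v x))
         + s\<^sup>2 * (\<Sum>y\<in>E `` {x}. \<omega> x y * (v y - v x) * (v y - v x))"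
    by (simp add: sum.distrib sum_distrib_left)
  finally show ?thesis
    by (simp add: energy_density_def Gam_def algebra_simps power2_eq_square add_divide_distrib)
qed

lemma energy_density_scaled:
  "energy_density E \<omega> \<mu> c (\<lambda>x. s * v x) (\<lambda>x. s * v x) x = s\<^sup>2 * energy_density E \<omega> \<mu> c v v x"
  using energy_density_add_scaled[of E \<omega> \<mu> c "\<lambda>_. 0" s v x] by simp

lemma tendsto_energy_density:
  assumes "\<And>x. (\<lambda>n. u n x) \<longlonglongrightarrow> v x"
  shows "(\<lambda>n. energy_density E \<omega> \<mu> c (u n) (u n) x) \<longlonglongrightarrow> energy_density E \<omega> \<mu> c v v x"
  unfolding energy_density_def Gam_def by (intro tendsto_intros assms)

section \<open>The graph and its energy\<close>

text \<open>
  The integrability of \<open>1 / (a + 1)\<close> is the form in which the growth of the potential is used: it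
  combines the finite volume of a sublevel set of \<open>a\<close> with the integrability of \<open>1 / a\<close> outside it.
\<close>

locale log_schrodinger =
  fixes E :: "('v \<times> 'v) set" and \<omega> :: "'v \<Rightarrow> 'v \<Rightarrow> real" and \<mu> a :: "'v \<Rightarrow> real"
    and \<mu>\<^sub>0 a\<^sub>0 :: real
  assumes sym_E: "sym E" and finite_nbrs: "\<And>x. finite (E `` {x})"
    and weight_nonneg: "\<And>x y. (x, y) \<in> E \<Longrightarrow> 0 \<le> \<omega> x y"
    and \<mu>\<^sub>0_pos: "0 < \<mu>\<^sub>0" and \<mu>_ge: "\<And>x. \<mu>\<^sub>0 \<le> \<mu> x"
    and a\<^sub>0_gt: "-1 < a\<^sub>0" and a\<^sub>0_neg: "a\<^sub>0 < 0" and a_ge: "\<And>x. a\<^sub>0 \<le> a x"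
    and integrable_inverse: "integrable (vertex_measure \<mu>) (\<lambda>x. 1 / (a x + 1))"
begin

abbreviation M :: "'v measure" where
  "M \<equiv> vertex_measure \<mu>"

abbreviation H :: "('v \<Rightarrow> real) set" where
  "H \<equiv> Hsp E \<omega> \<mu> a"

abbreviation b :: "'v \<Rightarrow> real" where
  "b \<equiv> \<lambda>x. a x + 1"

definition energy :: "('v \<Rightarrow> real) \<Rightarrow> real" where
  "energy u = (LINT x|M. energy_density E \<omega> \<mu> b u u x)"

definition mass :: "('v \<Rightarrow> real) \<Rightarrow> real" where
  "mass u = (LINT x|M. (u x)\<^sup>2)"

text \<open>
  The sign is opposite to that of the Shannon entropy of the density \<open>u\<^sup>2\<close>.
\<close>

definition entropy :: "('v \<Rightarrow> real) \<Rightarrow> real" where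
  "entropy u = (LINT x|M. sqlog (u x))"

definition finite_energy :: "('v \<Rightarrow> real) \<Rightarrow> bool" where
  "finite_energy u \<longleftrightarrow> integrable M (energy_density E \<omega> \<mu> b u u)"

lemma \<mu>_pos: "0 < \<mu> x"
  using \<mu>\<^sub>0_pos \<mu>_ge[of x] by linarith

lemma b_pos: "0 < b x"
  using a\<^sub>0_gt a_ge[of x] by linarith

lemma borel_measurable_vertex_measure [measurable, simp]: "f \<in> borel_measurable M"
  by (simp add: vertex_measure_def point_measure_def)

lemma grad_nonneg: "0 \<le> Gam E \<omega> \<mu> u u x"
proof -
  have "0 \<le> \<omega> x y * (u y - u x) * (u y - u x)" if "y \<in> E `` {x}" for y
    using weight_nonneg[of x y] that by (simp add: mult.assoc)
  then show ?thesis
    unfolding Gam_def using \<mu>_pos[of x] by (intro mult_nonneg_nonneg[of "1 / _"] sum_nonneg) auto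
qed

lemma energy_density_nonneg: "0 \<le> c x \<Longrightarrow> 0 \<le> energy_density E \<omega> \<mu> c u u x"
  unfolding energy_density_def by (intro add_nonneg_nonneg grad_nonneg) (simp add: mult.assoc)

lemma square_le_energy_density: "b x * (u x)\<^sup>2 \<le> energy_density E \<omega> \<mu> b u u x"
  using grad_nonneg[of u x] by (simp add: energy_density_def power2_eq_square mult.assoc)

lemma integrable_le:
  fixes f g :: "'v \<Rightarrow> real"
  assumes "integrable M g" "\<And>x. \<bar>f x\<bar> \<le> g x"
  shows "integrable M f"
  by (rule Bochner_Integration.integrable_bound[OF assms(1)])
    (use assms(2) in \<open>auto intro: order_trans[OF _ abs_ge_self]\<close>)

lemma integrable_finite_support:
  fixes f :: "'v \<Rightarrow> real"
  assumes "finite {x. f x \<noteq> 0}"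
  shows "integrable M f"
proof -
  have "finite {x \<in> UNIV. \<mu> x * f x \<noteq> 0}"
    by (rule finite_subset[OF _ assms]) auto
  then show ?thesis
    unfolding integrable_vertex_measure_iff[OF \<mu>_pos]
    by (rule finite_nonzero_values_imp_summable_on)
qed

lemma point_le_integral:
  fixes f :: "'v \<Rightarrow> real"
  assumes "integrable M f" "\<And>x. 0 \<le> f x"
  shows "\<mu> x * f x \<le> integral\<^sup>L M f"
proof -
  have "sum (\<lambda>x. \<mu> x * f x) {x} \<le> (\<Sum>\<^sub>\<infinity>x. \<mu> x * f x)"
    using assms \<mu>_pos by (intro finite_sum_le_infsum)
      (auto simp: integrable_vertex_measure_iff less_imp_le)
  then show ?thesis
    by (simp add: integral_vertex_measure[OF \<mu>_pos])
qed

text \<open>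
  A summable family has countable support, and \<open>\<mu> / b\<close> vanishes nowhere.
\<close>

lemma countable_vertices: "countable (UNIV :: 'v set)"
proof -
  have "countable {x \<in> UNIV. \<mu> x * (1 / b x) \<noteq> 0}"
    using integrable_inverse unfolding integrable_vertex_measure_iff[OF \<mu>_pos]
    by (rule summable_countable_real)
  moreover have "{x \<in> UNIV. \<mu> x * (1 / b x) \<noteq> 0} = UNIV"
    using \<mu>_pos b_pos by (auto simp: less_imp_neq[symmetric])
  ultimately show ?thesis by simp
qed

text \<open>
  Nonnegativity of the densities of \<open>u + v\<close> and \<open>u - v\<close> bounds the mixed density by the sum of the two
  pure ones.
\<close>

lemma integrable_energy_density:
  assumes "\<And>x. 0 \<le> c x" "integrable M (energy_density E \<omega> \<mu> c u u)"
    "integrable M (energy_density E \<omega> \<mu> c v v)"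
  shows "integrable M (energy_density E \<omega> \<mu> c u v)"
proof (rule integrable_le)
  show "integrable M (\<lambda>x. energy_density E \<omega> \<mu> c u u x + energy_density E \<omega> \<mu> c v v x)"
    using assms by simp
next
  fix x
  have "0 \<le> energy_density E \<omega> \<mu> c (\<lambda>x. u x + 1 * v x) (\<lambda>x. u x + 1 * v x) x"
    "0 \<le> energy_density E \<omega> \<mu> c (\<lambda>x. u x + (-1) * v x) (\<lambda>x. u x + (-1) * v x) x"
    "0 \<le> energy_density E \<omega> \<mu> c u u x" "0 \<le> energy_density E \<omega> \<mu> c v v x"
    by (intro energy_density_nonneg assms(1))+
  then show "\<bar>energy_density E \<omega> \<mu> c u v x\<bar> \<le> energy_density E \<omega> \<mu> c u u x + energy_density E \<omega> \<mu> c v v x"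
    unfolding energy_density_add_scaled by (auto simp: abs_le_iff)
qed

lemma
  assumes "\<And>x. 0 \<le> c x" "integrable M (energy_density E \<omega> \<mu> c u u)"
    "integrable M (energy_density E \<omega> \<mu> c v v)"
  shows integrable_energy_density_add_scaled:
      "integrable M (energy_density E \<omega> \<mu> c (\<lambda>x. u x + s * v x) (\<lambda>x. u x + s * v x))"
    and integral_energy_density_add_scaled:
      "(LINT x|M. energy_density E \<omega> \<mu> c (\<lambda>x. u x + s * v x) (\<lambda>x. u x + s * v x) x)
        = (LINT x|M. energy_density E \<omega> \<mu> c u u x) + 2 * s * (LINT x|M. energy_density E \<omega> \<mu> c u v x)
          + s\<^sup>2 * (LINT x|M. energy_density E \<omega> \<mu> c v v x)"
proof -
  note int = assms(2,3) integrable_energy_density[OF assms]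
  have eq: "energy_density E \<omega> \<mu> c (\<lambda>x. u x + s * v x) (\<lambda>x. u x + s * v x) =
    (\<lambda>x. energy_density E \<omega> \<mu> c u u x + 2 * s * energy_density E \<omega> \<mu> c u v x
      + s\<^sup>2 * energy_density E \<omega> \<mu> c v v x)"
    by (rule ext) (rule energy_density_add_scaled)
  show "integrable M (energy_density E \<omega> \<mu> c (\<lambda>x. u x + s * v x) (\<lambda>x. u x + s * v x))"
    unfolding eq using int by simp
  show "(LINT x|M. energy_density E \<omega> \<mu> c (\<lambda>x. u x + s * v x) (\<lambda>x. u x + s * v x) x)
        = (LINT x|M. energy_density E \<omega> \<mu> c u u x) + 2 * s * (LINT x|M. energy_density E \<omega> \<mu> c u v x)
          + s\<^sup>2 * (LINT x|M. energy_density E \<omega> \<mu> c v v x)"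
    unfolding eq using int by simp
qed

lemma integral_energy_density_nonneg:
  assumes "\<And>x. 0 \<le> c x" shows "0 \<le> (LINT x|M. energy_density E \<omega> \<mu> c u u x)"
  using assms by (simp add: energy_density_nonneg)

lemma integral_energy_density_add_scaled_le:
  assumes "\<And>x. 0 \<le> c x" "integrable M (energy_density E \<omega> \<mu> c u u)"
    "integrable M (energy_density E \<omega> \<mu> c v v)"
  shows "(LINT x|M. energy_density E \<omega> \<mu> c (\<lambda>x. u x + s * v x) (\<lambda>x. u x + s * v x) x)
        \<le> 2 * (LINT x|M. energy_density E \<omega> \<mu> c u u x)
          + 2 * s\<^sup>2 * (LINT x|M. energy_density E \<omega> \<mu> c v v x)"
  using integral_energy_density_add_scaled[OF assms, of s]
    integral_energy_density_add_scaled[OF assms, of "- s"]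
    integral_energy_density_nonneg[of c "\<lambda>x. u x + - s * v x"] assms(1)
  by simp

lemma finite_energy_add_scaled:
  "finite_energy u \<Longrightarrow> finite_energy v \<Longrightarrow> finite_energy (\<lambda>x. u x + s * v x)"
  unfolding finite_energy_def
  by (rule integrable_energy_density_add_scaled) (use b_pos in \<open>auto intro: less_imp_le\<close>)

lemma finite_energy_scaled: "finite_energy v \<Longrightarrow> finite_energy (\<lambda>x. s * v x)"
  unfolding finite_energy_def energy_density_scaled[abs_def] by simp

lemma energy_nonneg: "0 \<le> energy u"
  unfolding energy_def by (intro integral_energy_density_nonneg less_imp_le b_pos)

lemma energy_scaled: "energy (\<lambda>x. s * v x) = s\<^sup>2 * energy v"
  unfolding energy_def energy_density_scaled by simp

lemma energy_add_scaled:
  "finite_energy u \<Longrightarrow> finite_energy v \<Longrightarrow>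
    energy (\<lambda>x. u x + s * v x)
      = energy u + 2 * s * (LINT x|M. energy_density E \<omega> \<mu> b u v x) + s\<^sup>2 * energy v"
  unfolding finite_energy_def energy_def
  by (rule integral_energy_density_add_scaled) (use b_pos in \<open>auto intro: less_imp_le\<close>)

lemma energy_add_scaled_le:
  "finite_energy u \<Longrightarrow> finite_energy v \<Longrightarrow> energy (\<lambda>x. u x + s * v x) \<le> 2 * energy u + 2 * s\<^sup>2 * energy v"
  unfolding finite_energy_def energy_def
  by (rule integral_energy_density_add_scaled_le) (use b_pos in \<open>auto intro: less_imp_le\<close>)

lemma finite_energy_integrable_weighted:
  assumes "finite_energy u" shows "integrable M (\<lambda>x. b x * (u x)\<^sup>2)"
  by (rule integrable_le[OF assms[unfolded finite_energy_def]])
    (use square_le_energy_density b_pos in \<open>auto simp: abs_mult abs_of_pos\<close>)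

lemma finite_energy_integrable_square:
  assumes "finite_energy u" shows "integrable M (\<lambda>x. (u x)\<^sup>2)"
proof (rule integrable_le)
  show "integrable M (\<lambda>x. (1 / (a\<^sub>0 + 1)) * (b x * (u x)\<^sup>2))"
    using finite_energy_integrable_weighted[OF assms] by simp
  show "\<bar>(u x)\<^sup>2\<bar> \<le> (1 / (a\<^sub>0 + 1)) * (b x * (u x)\<^sup>2)" for x
  proof -
    have "(a\<^sub>0 + 1) * (u x)\<^sup>2 \<le> b x * (u x)\<^sup>2"
      using a_ge by (intro mult_right_mono) auto
    then show ?thesis
      using a\<^sub>0_gt by (simp add: field_simps)
  qed
qed

text \<open>
  The inequality between arithmetic and geometric means, split so that a small multiple of the energy
  controls \<open>\<bar>t\<bar>\<close> up to a multiple of the fixed integrable function \<open>1 / b\<close>.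
\<close>

lemma abs_le_weighted:
  assumes "0 < \<epsilon>"
  shows "\<bar>t\<bar> \<le> \<epsilon> / 2 * (b x * t\<^sup>2) + 1 / (2 * \<epsilon>) * (1 / b x)"
proof -
  define B s where "B = b x" and "s = \<bar>t\<bar>"
  have B: "0 < B" using b_pos[of x] by (simp add: B_def)
  have "0 \<le> (\<epsilon> * B * s - 1)\<^sup>2 / (2 * \<epsilon> * B)"
    using assms B by (intro divide_nonneg_pos) auto
  also have "\<dots> = \<epsilon> / 2 * (B * s\<^sup>2) + 1 / (2 * \<epsilon>) * (1 / B) - s"
    using assms B by (simp add: field_simps power2_eq_square)
  finally show ?thesis by (simp add: B_def s_def)
qed

lemma finite_energy_integrable:
  assumes "finite_energy u" shows "integrable M u"
proof (rule integrable_le)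
  show "integrable M (\<lambda>x. 1 / 2 * (b x * (u x)\<^sup>2) + 1 / (2 * 1) * (1 / b x))"
    using finite_energy_integrable_weighted[OF assms] integrable_inverse
    by (intro Bochner_Integration.integrable_add integrable_mult_right) auto
qed (use abs_le_weighted[of 1] in simp)

text \<open>
  A single vertex already carries mass at least \<open>\<mu>\<^sub>0 (u x)\<^sup>2\<close>.
\<close>

lemma abs_le_mass:
  assumes "finite_energy u" shows "\<bar>u x\<bar> \<le> sqrt (mass u / \<mu>\<^sub>0)"
proof (rule real_le_rsqrt)
  have "\<mu>\<^sub>0 * (u x)\<^sup>2 \<le> \<mu> x * (u x)\<^sup>2"
    using \<mu>_ge by (intro mult_right_mono) auto
  also have "\<dots> \<le> mass u"
    unfolding mass_def by (rule point_le_integral) (use finite_energy_integrable_square[OF assms] in auto)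
  finally show "\<bar>u x\<bar>\<^sup>2 \<le> mass u / \<mu>\<^sub>0"
    using \<mu>\<^sub>0_pos by (simp add: field_simps)
qed

lemma mass_nonneg: "0 \<le> mass u"
  by (simp add: mass_def)

section \<open>Compactness in \<open>L\<^sup>1\<close>\<close>

lemma energy_Fatou:
  assumes fin: "\<And>n. finite_energy (u n)" and le: "\<And>n. energy (u n) \<le> c n" and c: "c \<longlonglongrightarrow> l"
    and lim: "\<And>x. (\<lambda>n. u n x) \<longlonglongrightarrow> v x"
  shows "finite_energy v" "energy v \<le> l"
proof -
  have "0 \<le> energy_density E \<omega> \<mu> b (u n) (u n) x" for n x
    by (intro energy_density_nonneg less_imp_le b_pos)
  note Fatou = integrable_Fatou[OF fin[unfolded finite_energy_def] this tendsto_energy_density[OF lim]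
      le[unfolded energy_def] c]
  from Fatou show "finite_energy v" "energy v \<le> l"
    by (simp_all add: finite_energy_def energy_def)
qed

text \<open>
  Let \<open>w n = u n - v\<close>.  In \<open>abs_le_weighted\<close> the term \<open>1 / (2 \<epsilon> b)\<close> may be replaced by its minimum
  with \<open>\<bar>w n\<bar>\<close>.  That minimum tends to 0 pointwise and is dominated by an integrable function, so its
  integral vanishes in the limit, while the energy contributes at most a multiple of \<open>\<epsilon>\<close>.
\<close>

lemma L1_convergence:
  assumes fin: "\<And>n. finite_energy (u n)" and le: "\<And>n. energy (u n) \<le> K"
    and lim: "\<And>x. (\<lambda>n. u n x) \<longlonglongrightarrow> v x"
  shows "finite_energy v" "(\<lambda>n. LINT x|M. \<bar>u n x - v x\<bar>) \<longlonglongrightarrow> 0"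
proof -
  note Fatou = energy_Fatou[OF fin le tendsto_const lim]
  from Fatou(1) show v: "finite_energy v" .
  from Fatou(2) have enK: "energy v \<le> K" .
  define w where "w n x = u n x + (-1) * v x" for n x
  have w: "finite_energy (w n)" for n
    unfolding w_def[abs_def] by (intro finite_energy_add_scaled fin v)
  have enw: "energy (w n) \<le> 4 * K" for n
    using energy_add_scaled_le[OF fin[of n] v, of "-1"] le[of n] enK unfolding w_def[abs_def] by simp
  have w0: "(\<lambda>n. w n x) \<longlonglongrightarrow> 0" for x
    unfolding w_def using tendsto_diff[OF lim[of x] tendsto_const[of "v x"]] by simp
  have K: "0 \<le> K" using le[of 0] energy_nonneg[of "u 0"] by simp
  have "\<exists>N. \<forall>n\<ge>N. (LINT x|M. \<bar>w n x\<bar>) < r" if r: "0 < r" for r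
  proof -
    \<comment> \<open>The energy of \<open>w n\<close> is at most \<open>4 K\<close>, so its part \<open>\<epsilon> / 2 * (4 * K)\<close> stays below \<open>r / 2\<close>.\<close>
    define \<epsilon> where "\<epsilon> = r / (4 * (K + 1))"
    have \<epsilon>: "0 < \<epsilon>" using r K by (simp add: \<epsilon>_def)
    define g where "g n x = min \<bar>w n x\<bar> (1 / (2 * \<epsilon>) * (1 / b x))" for n x
    have gint: "integrable M (g n)" for n
      by (rule integrable_le[OF integrable_abs[OF finite_energy_integrable[OF w[of n]]]])
        (use \<epsilon> b_pos in \<open>auto simp: g_def abs_of_pos min_def\<close>)
    have "(\<lambda>n. integral\<^sup>L M (g n)) \<longlonglongrightarrow> (LINT x|M. 0)"
    proof (rule integral_dominated_convergence)
      show "integrable M (\<lambda>x. 1 / (2 * \<epsilon>) * (1 / b x))"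
        using integrable_inverse by (rule integrable_mult_right)
      have "(\<lambda>n. g n x) \<longlonglongrightarrow> min \<bar>0\<bar> (1 / (2 * \<epsilon>) * (1 / b x))" for x
        unfolding g_def by (intro tendsto_intros w0)
      moreover have "min \<bar>0\<bar> (1 / (2 * \<epsilon>) * (1 / b x)) = 0" for x
        using \<epsilon> b_pos[of x] by (simp add: min_def)
      ultimately show "AE x in M. (\<lambda>n. g n x) \<longlonglongrightarrow> 0" by simp
      show "AE x in M. norm (g n x) \<le> 1 / (2 * \<epsilon>) * (1 / b x)" for n
        using \<epsilon> b_pos by (auto simp: g_def min_def less_imp_le intro!: AE_I2)
    qed auto
    then obtain N where N: "\<And>n. N \<le> n \<Longrightarrow> integral\<^sup>L M (g n) < r / 2"
      using r order_tendstoD(2)[of _ 0 sequentially "r / 2"] unfolding eventually_sequentially by auto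
    have "(LINT x|M. \<bar>w n x\<bar>) < r" if "N \<le> n" for n
    proof -
      have "(LINT x|M. \<bar>w n x\<bar>) \<le> (LINT x|M. \<epsilon> / 2 * energy_density E \<omega> \<mu> b (w n) (w n) x + g n x)"
      proof (rule integral_mono)
        show "integrable M (\<lambda>x. \<bar>w n x\<bar>)"
          by (intro integrable_abs finite_energy_integrable w)
        show "integrable M (\<lambda>x. \<epsilon> / 2 * energy_density E \<omega> \<mu> b (w n) (w n) x + g n x)"
          using gint w[of n] unfolding finite_energy_def by simp
        fix x
        have "0 \<le> \<epsilon> / 2 * (b x * (w n x)\<^sup>2)"
          using \<epsilon> b_pos[of x] by simp
        then have "\<bar>w n x\<bar> \<le> \<epsilon> / 2 * (b x * (w n x)\<^sup>2) + g n x"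
          using abs_le_weighted[OF \<epsilon>, of "w n x" x] unfolding g_def by linarith
        also have "\<epsilon> / 2 * (b x * (w n x)\<^sup>2) \<le> \<epsilon> / 2 * energy_density E \<omega> \<mu> b (w n) (w n) x"
          using \<epsilon> by (intro mult_left_mono square_le_energy_density) auto
        finally show "\<bar>w n x\<bar> \<le> \<epsilon> / 2 * energy_density E \<omega> \<mu> b (w n) (w n) x + g n x" by simp
      qed
      also have "\<dots> = \<epsilon> / 2 * energy (w n) + integral\<^sup>L M (g n)"
        using gint w[of n] unfolding finite_energy_def energy_def by simp
      also have "\<dots> < \<epsilon> / 2 * (4 * K) + r / 2"
        using N[OF that] \<epsilon> enw[of n] by (intro add_le_less_mono mult_left_mono) auto
      also have "\<dots> \<le> r"
        using r K by (simp add: \<epsilon>_def field_simps)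
      finally show ?thesis .
    qed
    then show ?thesis by blast
  qed
  then show "(\<lambda>n. LINT x|M. \<bar>u n x - v x\<bar>) \<longlonglongrightarrow> 0"
    by (auto simp: LIMSEQ_iff w_def)
qed

text \<open>
  For uniformly bounded functions, convergence in \<open>L\<^sup>1\<close> suffices to pass to the limit under any locally
  Lipschitz nonlinearity vanishing at 0; this is applied to \<open>t\<^sup>2\<close> and to \<open>t\<^sup>2 log t\<^sup>2\<close>.
\<close>

lemma tendsto_integral_lipschitz:
  fixes g :: "real \<Rightarrow> real"
  assumes u: "\<And>n. finite_energy (u n)" "\<And>n x. \<bar>u n x\<bar> \<le> R" and v: "finite_energy v" "\<And>x. \<bar>v x\<bar> \<le> R"
    and lim: "(\<lambda>n. LINT x|M. \<bar>u n x - v x\<bar>) \<longlonglongrightarrow> 0"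
    and g: "\<And>s t. \<bar>s\<bar> \<le> R \<Longrightarrow> \<bar>t\<bar> \<le> R \<Longrightarrow> \<bar>g s - g t\<bar> \<le> C * \<bar>s - t\<bar>" "g 0 = 0"
  shows "(\<lambda>n. LINT x|M. g (u n x)) \<longlonglongrightarrow> (LINT x|M. g (v x))"
proof -
  have R: "0 \<le> R" using u(2)[of 0] abs_ge_zero order_trans by blast
  have int: "integrable M (\<lambda>x. g (w x))" if "finite_energy w" "\<And>x. \<bar>w x\<bar> \<le> R" for w
  proof (rule integrable_le)
    show "integrable M (\<lambda>x. C * \<bar>w x\<bar>)"
      using finite_energy_integrable[OF that(1)] by simp
  qed (use g(1)[OF that(2), of 0] g(2) R in simp)
  have "(\<lambda>n. (LINT x|M. g (u n x)) - (LINT x|M. g (v x))) \<longlonglongrightarrow> 0"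
  proof (rule Lim_null_comparison)
    show "(\<lambda>n. C * (LINT x|M. \<bar>u n x - v x\<bar>)) \<longlonglongrightarrow> 0"
      using tendsto_mult_left[OF lim, of C] by simp
    have "\<bar>(LINT x|M. g (u n x)) - (LINT x|M. g (v x))\<bar> \<le> C * (LINT x|M. \<bar>u n x - v x\<bar>)" for n
    proof -
      have "\<bar>(LINT x|M. g (u n x)) - (LINT x|M. g (v x))\<bar> = \<bar>LINT x|M. g (u n x) - g (v x)\<bar>"
        by (subst Bochner_Integration.integral_diff) (use int u v in auto)
      also have "\<dots> \<le> (LINT x|M. \<bar>g (u n x) - g (v x)\<bar>)"
        by (rule integral_abs_bound)
      also have "\<dots> \<le> (LINT x|M. C * \<bar>u n x - v x\<bar>)"
        by (intro integral_mono integrable_abs Bochner_Integration.integrable_diff int u v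
            integrable_mult_right finite_energy_integrable g(1))
      finally show ?thesis by simp
    qed
    then show "\<forall>\<^sub>F n in sequentially. norm ((LINT x|M. g (u n x)) - (LINT x|M. g (v x)))
        \<le> C * (LINT x|M. \<bar>u n x - v x\<bar>)" by simp
  qed
  then show ?thesis by (simp add: LIM_zero_iff)
qed

section \<open>The space of finite energy functions approximable by finitely supported ones\<close>

abbreviation one :: "'v \<Rightarrow> real" where
  "one \<equiv> \<lambda>_. 1"

text \<open>
  Differences are written as \<open>u + (-1) * v\<close> here and below, so that they are instances of the rules
  for \<open>u + s * v\<close>.
\<close>

definition Cc_limit :: "('v \<Rightarrow> real) \<Rightarrow> bool" where
  "Cc_limit u \<longleftrightarrow> (\<exists>\<phi>. (\<forall>n. \<phi> n \<in> Cc) \<and>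
    (\<lambda>n. LINT x|M. energy_density E \<omega> \<mu> one (\<lambda>x. \<phi> n x + (-1) * u x) (\<lambda>x. \<phi> n x + (-1) * u x) x) \<longlonglongrightarrow> 0)"

lemma grad_sq_plus_square: "grad_sq E \<omega> \<mu> u x + (u x)\<^sup>2 = energy_density E \<omega> \<mu> one u u x"
  by (simp add: grad_sq_def energy_density_def power2_eq_square)

lemma H1_norm_tendsto_0_iff:
  "(\<lambda>n. H1_norm E \<omega> \<mu> (u n)) \<longlonglongrightarrow> 0 \<longleftrightarrow> (\<lambda>n. LINT x|M. energy_density E \<omega> \<mu> one (u n) (u n) x) \<longlonglongrightarrow> 0"
proof -
  have eq: "H1_norm E \<omega> \<mu> v = sqrt (LINT x|M. energy_density E \<omega> \<mu> one v v x)" for v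
    unfolding H1_norm_def grad_sq_plus_square ..
  have sq: "(LINT x|M. energy_density E \<omega> \<mu> one v v x) = (H1_norm E \<omega> \<mu> v)\<^sup>2" for v
    unfolding eq by (simp add: integral_energy_density_nonneg)
  show ?thesis
  proof
    assume "(\<lambda>n. H1_norm E \<omega> \<mu> (u n)) \<longlonglongrightarrow> 0"
    from tendsto_power[OF this, of 2] show "(\<lambda>n. LINT x|M. energy_density E \<omega> \<mu> one (u n) (u n) x) \<longlonglongrightarrow> 0"
      unfolding sq by simp
  next
    assume "(\<lambda>n. LINT x|M. energy_density E \<omega> \<mu> one (u n) (u n) x) \<longlonglongrightarrow> 0"
    from tendsto_real_sqrt[OF this] show "(\<lambda>n. H1_norm E \<omega> \<mu> (u n)) \<longlonglongrightarrow> 0"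
      unfolding eq by simp
  qed
qed

lemma
  assumes "finite_energy u"
  shows finite_energy_integrable_one: "integrable M (energy_density E \<omega> \<mu> one u u)"
    and integral_one_le_energy: "(LINT x|M. energy_density E \<omega> \<mu> one u u x) \<le> 1 / (a\<^sub>0 + 1) * energy u"
proof -
  have le: "energy_density E \<omega> \<mu> one u u x \<le> 1 / (a\<^sub>0 + 1) * energy_density E \<omega> \<mu> b u u x" for x
  proof -
    have "(a\<^sub>0 + 1) * (u x)\<^sup>2 \<le> b x * (u x)\<^sup>2"
      using a_ge by (intro mult_right_mono) auto
    moreover have "(a\<^sub>0 + 1) * Gam E \<omega> \<mu> u u x \<le> 1 * Gam E \<omega> \<mu> u u x"
      using a\<^sub>0_neg by (intro mult_right_mono grad_nonneg) auto
    ultimately have "(a\<^sub>0 + 1) * energy_density E \<omega> \<mu> one u u x \<le> energy_density E \<omega> \<mu> b u u x"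
      by (simp add: energy_density_def power2_eq_square algebra_simps)
    then show ?thesis
      using a\<^sub>0_gt by (simp add: field_simps)
  qed
  have int: "integrable M (\<lambda>x. 1 / (a\<^sub>0 + 1) * energy_density E \<omega> \<mu> b u u x)"
    using assms unfolding finite_energy_def by (rule integrable_mult_right)
  show 1: "integrable M (energy_density E \<omega> \<mu> one u u)"
    by (rule integrable_le[OF int]) (use le energy_density_nonneg[of one] in simp)
  have "(LINT x|M. energy_density E \<omega> \<mu> one u u x)
      \<le> (LINT x|M. 1 / (a\<^sub>0 + 1) * energy_density E \<omega> \<mu> b u u x)"
    by (rule integral_mono[OF 1 int le])
  then show "(LINT x|M. energy_density E \<omega> \<mu> one u u x) \<le> 1 / (a\<^sub>0 + 1) * energy u"
    unfolding energy_def by simp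
qed

text \<open>
  Since \<open>b \<ge> a\<^sub>0 + 1 > 0\<close>, finiteness of the energy is equivalent to membership in the space of finite
  \<open>H1_norm\<close> together with integrability of \<open>a u\<^sup>2\<close>; approximability in the \<open>H1\<close> norm remains a separate
  condition.
\<close>

lemma Hsp_iff: "u \<in> H \<longleftrightarrow> finite_energy u \<and> Cc_limit u"
proof -
  have "integrable M (energy_density E \<omega> \<mu> one u u) \<and> integrable M (\<lambda>x. a x * (u x)\<^sup>2) \<longleftrightarrow> finite_energy u"
  proof
    assume int: "integrable M (energy_density E \<omega> \<mu> one u u) \<and> integrable M (\<lambda>x. a x * (u x)\<^sup>2)"
    have "energy_density E \<omega> \<mu> b u u = (\<lambda>x. energy_density E \<omega> \<mu> one u u x + a x * (u x)\<^sup>2)"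
      by (auto simp: energy_density_def power2_eq_square algebra_simps)
    with int show "finite_energy u" by (simp add: finite_energy_def)
  next
    assume fin: "finite_energy u"
    have "(\<lambda>x. a x * (u x)\<^sup>2) = (\<lambda>x. b x * (u x)\<^sup>2 - (u x)\<^sup>2)"
      by (auto simp: algebra_simps)
    then show "integrable M (energy_density E \<omega> \<mu> one u u) \<and> integrable M (\<lambda>x. a x * (u x)\<^sup>2)"
      using finite_energy_integrable_one[OF fin] finite_energy_integrable_weighted[OF fin]
        finite_energy_integrable_square[OF fin] by simp
  qed
  then show ?thesis
    unfolding Hsp_def H1_def Cc_limit_def grad_sq_plus_square H1_norm_tendsto_0_iff by auto
qed

lemma H_finite_energy: "u \<in> H \<Longrightarrow> finite_energy u"
  by (simp add: Hsp_iff)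

text \<open>
  The gradient of a finitely supported function lives on the support and its neighbours, a finite set.
\<close>

lemma Cc_integrable_energy_density:
  assumes "u \<in> Cc" shows "integrable M (energy_density E \<omega> \<mu> c u u)"
proof (rule integrable_finite_support)
  have "{x. energy_density E \<omega> \<mu> c u u x \<noteq> 0} \<subseteq> {x. u x \<noteq> 0} \<union> (\<Union>y\<in>{x. u x \<noteq> 0}. E `` {y})"
  proof
    fix x assume x: "x \<in> {x. energy_density E \<omega> \<mu> c u u x \<noteq> 0}"
    show "x \<in> {x. u x \<noteq> 0} \<union> (\<Union>y\<in>{x. u x \<noteq> 0}. E `` {y})"
    proof (rule ccontr)
      assume not: "x \<notin> {x. u x \<noteq> 0} \<union> (\<Union>y\<in>{x. u x \<noteq> 0}. E `` {y})"
      have "u y = 0" if "y \<in> E `` {x}" for y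
        using not that sym_E by (auto dest: symD)
      with not have "energy_density E \<omega> \<mu> c u u x = 0"
        by (simp add: energy_density_def Gam_def)
      with x show False by simp
    qed
  qed
  then show "finite {x. energy_density E \<omega> \<mu> c u u x \<noteq> 0}"
    using assms finite_nbrs by (auto simp: Cc_def intro: finite_subset)
qed

lemma Cc_subset_H: "Cc \<subseteq> H"
proof
  fix u :: "'v \<Rightarrow> real" assume u: "u \<in> Cc"
  have "Cc_limit u"
    unfolding Cc_limit_def using u by (intro exI[of _ "\<lambda>_. u"]) simp
  with Cc_integrable_energy_density[OF u] show "u \<in> H"
    by (simp add: Hsp_iff finite_energy_def)
qed

lemma Cc_add_scaled:
  assumes "\<phi> \<in> Cc" "\<psi> \<in> Cc" shows "(\<lambda>x. \<phi> x + s * \<psi> x) \<in> Cc"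
proof -
  have "{x. \<phi> x + s * \<psi> x \<noteq> 0} \<subseteq> {x. \<phi> x \<noteq> 0} \<union> {x. \<psi> x \<noteq> 0}" by auto
  then show ?thesis
    using assms by (auto simp: Cc_def intro: finite_subset)
qed

lemma H_add_scaled:
  assumes u: "u \<in> H" and v: "v \<in> H" shows "(\<lambda>x. u x + s * v x) \<in> H"
proof -
  let ?N = "\<lambda>u. LINT x|M. energy_density E \<omega> \<mu> one u u x"
  let ?d = "\<lambda>\<phi> u n x. \<phi> n x + (-1) * u x :: real"
  obtain \<phi> \<psi> where \<phi>: "\<And>n. \<phi> n \<in> Cc" "(\<lambda>n. ?N (?d \<phi> u n)) \<longlonglongrightarrow> 0"
    and \<psi>: "\<And>n. \<psi> n \<in> Cc" "(\<lambda>n. ?N (?d \<psi> v n)) \<longlonglongrightarrow> 0"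
    using u v unfolding Hsp_iff Cc_limit_def by blast
  have int: "integrable M (energy_density E \<omega> \<mu> one (?d \<theta> w n) (?d \<theta> w n))"
    if "\<And>n. \<theta> n \<in> Cc" "w \<in> H" for \<theta> w n
    using that by (intro integrable_energy_density_add_scaled Cc_integrable_energy_density
        finite_energy_integrable_one H_finite_energy) auto
  have "Cc_limit (\<lambda>x. u x + s * v x)"
    unfolding Cc_limit_def
  proof (intro exI conjI allI)
    show "(\<lambda>x. \<phi> n x + s * \<psi> n x) \<in> Cc" for n
      by (intro Cc_add_scaled \<phi> \<psi>)
    have "(\<lambda>n. ?N (\<lambda>x. ?d \<phi> u n x + s * ?d \<psi> v n x)) \<longlonglongrightarrow> 0"
    proof (rule tendsto_sandwich[OF _ _ tendsto_const])
      show "\<forall>\<^sub>F n in sequentially. ?N (\<lambda>x. ?d \<phi> u n x + s * ?d \<psi> v n x)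
          \<le> 2 * ?N (?d \<phi> u n) + 2 * s\<^sup>2 * ?N (?d \<psi> v n)"
        by (intro always_eventually allI integral_energy_density_add_scaled_le int \<phi> \<psi> u v) auto
      have "(\<lambda>n. 2 * ?N (?d \<phi> u n) + 2 * s\<^sup>2 * ?N (?d \<psi> v n)) \<longlonglongrightarrow> 2 * 0 + 2 * s\<^sup>2 * 0"
        by (intro tendsto_intros \<phi> \<psi>)
      then show "(\<lambda>n. 2 * ?N (?d \<phi> u n) + 2 * s\<^sup>2 * ?N (?d \<psi> v n)) \<longlonglongrightarrow> 0" by simp
    qed (auto intro!: always_eventually integral_energy_density_nonneg)
    moreover have "(\<lambda>x. ?d \<phi> u n x + s * ?d \<psi> v n x)
        = (\<lambda>x. \<phi> n x + s * \<psi> n x + (-1) * (u x + s * v x))" for n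
      by (auto simp: algebra_simps)
    ultimately show "(\<lambda>n. ?N (\<lambda>x. \<phi> n x + s * \<psi> n x + (-1) * (u x + s * v x))) \<longlonglongrightarrow> 0"
      by simp
  qed
  then show ?thesis
    using u v by (simp add: Hsp_iff finite_energy_add_scaled)
qed

lemma H_scaled: "v \<in> H \<Longrightarrow> (\<lambda>x. s * v x) \<in> H"
  using H_add_scaled[of "\<lambda>_. 0" v s] subsetD[OF Cc_subset_H, of "\<lambda>_. 0"] by (simp add: Cc_def)

text \<open>
  The energy dominates the squared \<open>H1\<close> norm, so approximating each \<open>u n\<close> up to \<open>1 / (n + 1)\<close> by a
  finitely supported function gives a sequence approximating the limit.
\<close>

lemma H_closed:
  assumes u: "\<And>n. u n \<in> H" and v: "finite_energy v"
    and lim: "(\<lambda>n. energy (\<lambda>x. u n x + (-1) * v x)) \<longlonglongrightarrow> 0"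
  shows "v \<in> H"
proof -
  let ?N = "\<lambda>u. LINT x|M. energy_density E \<omega> \<mu> one u u x"
  have "\<exists>\<phi>. \<phi> \<in> Cc \<and> ?N (\<lambda>x. \<phi> x + (-1) * u n x) < inverse (Suc n)" for n
  proof -
    obtain \<psi> where \<psi>: "\<And>k. \<psi> k \<in> Cc" "(\<lambda>k. ?N (\<lambda>x. \<psi> k x + (-1) * u n x)) \<longlonglongrightarrow> 0"
      using u[of n] unfolding Hsp_iff Cc_limit_def by blast
    have "\<forall>\<^sub>F k in sequentially. ?N (\<lambda>x. \<psi> k x + (-1) * u n x) < inverse (Suc n)"
      by (rule order_tendstoD(2)[OF \<psi>(2)]) simp
    then obtain k where "?N (\<lambda>x. \<psi> k x + (-1) * u n x) < inverse (Suc n)"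
      unfolding eventually_sequentially by blast
    with \<psi>(1) show ?thesis by blast
  qed
  then have "\<forall>n. \<exists>\<phi>. \<phi> \<in> Cc \<and> ?N (\<lambda>x. \<phi> x + (-1) * u n x) < inverse (Suc n)"
    by (rule allI)
  then obtain \<phi> where "\<forall>n. \<phi> n \<in> Cc \<and> ?N (\<lambda>x. \<phi> n x + (-1) * u n x) < inverse (Suc n)"
    by (rule choice[THEN exE])
  then have \<phi>: "\<And>n. \<phi> n \<in> Cc" "\<And>n. ?N (\<lambda>x. \<phi> n x + (-1) * u n x) < inverse (Suc n)"
    by blast+
  have fin: "finite_energy (\<lambda>x. u n x + (-1) * v x)" for n
    by (intro finite_energy_add_scaled v H_finite_energy u)
  have "(\<lambda>n. ?N (\<lambda>x. \<phi> n x + (-1) * v x)) \<longlonglongrightarrow> 0"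
  proof (rule tendsto_sandwich[OF _ _ tendsto_const])
    have "?N (\<lambda>x. \<phi> n x + (-1) * v x)
        \<le> 2 * inverse (Suc n) + 2 * (1 / (a\<^sub>0 + 1) * energy (\<lambda>x. u n x + (-1) * v x))" for n
    proof -
      have "(\<lambda>x. \<phi> n x + (-1) * v x) = (\<lambda>x. (\<phi> n x + (-1) * u n x) + 1 * (u n x + (-1) * v x))"
        by (auto simp: algebra_simps)
      then have "?N (\<lambda>x. \<phi> n x + (-1) * v x)
          = ?N (\<lambda>x. (\<phi> n x + (-1) * u n x) + 1 * (u n x + (-1) * v x))" by presburger
      also have "\<dots> \<le> 2 * ?N (\<lambda>x. \<phi> n x + (-1) * u n x) + 2 * 1\<^sup>2 * ?N (\<lambda>x. u n x + (-1) * v x)"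
        by (intro integral_energy_density_add_scaled_le integrable_energy_density_add_scaled
            Cc_integrable_energy_density
            finite_energy_integrable_one H_finite_energy \<phi> u v) auto
      also have "\<dots> \<le> 2 * inverse (Suc n) + 2 * (1 / (a\<^sub>0 + 1) * energy (\<lambda>x. u n x + (-1) * v x))"
        using \<phi>(2)[of n] integral_one_le_energy[OF fin, of n] by simp
      finally show ?thesis .
    qed
    then show "\<forall>\<^sub>F n in sequentially. ?N (\<lambda>x. \<phi> n x + (-1) * v x)
        \<le> 2 * inverse (Suc n) + 2 * (1 / (a\<^sub>0 + 1) * energy (\<lambda>x. u n x + (-1) * v x))" by simp
    have "(\<lambda>n. 2 * inverse (Suc n) + 2 * (1 / (a\<^sub>0 + 1) * energy (\<lambda>x. u n x + (-1) * v x)))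
        \<longlonglongrightarrow> 2 * 0 + 2 * (1 / (a\<^sub>0 + 1) * 0)"
      by (intro tendsto_intros LIMSEQ_inverse_real_of_nat lim)
    then show "(\<lambda>n. 2 * inverse (Suc n) + 2 * (1 / (a\<^sub>0 + 1) * energy (\<lambda>x. u n x + (-1) * v x))) \<longlonglongrightarrow> 0"
      by simp
  qed (auto intro!: always_eventually integral_energy_density_nonneg)
  with \<phi>(1) v show ?thesis
    unfolding Hsp_iff Cc_limit_def by blast
qed

section \<open>The functional and its scaling\<close>

lemma J_eq: "J E \<omega> \<mu> a u = 1 / 2 * (energy u - entropy u)"
proof -
  have "(Hsp_norm E \<omega> \<mu> a u)\<^sup>2 = energy u"
    using energy_nonneg[of u] unfolding Hsp_norm_def energy_def energy_density_def grad_sq_def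
    by (simp add: power2_eq_square mult.assoc)
  then show ?thesis
    by (simp add: J_def entropy_def sqlog_def algebra_simps)
qed

lemma integrable_sqlog:
  assumes "finite_energy u" shows "integrable M (\<lambda>x. sqlog (u x))"
proof -
  define R where "R = sqrt (mass u / \<mu>\<^sub>0)"
  obtain C where C: "\<And>s t. \<bar>s\<bar> \<le> R \<Longrightarrow> \<bar>t\<bar> \<le> R \<Longrightarrow> \<bar>sqlog s - sqlog t\<bar> \<le> C * \<bar>s - t\<bar>"
    using sqlog_lipschitz[of R] by blast
  have "0 \<le> R" using mass_nonneg \<mu>\<^sub>0_pos by (simp add: R_def)
  show ?thesis
  proof (rule integrable_le)
    show "integrable M (\<lambda>x. C * \<bar>u x\<bar>)"
      using finite_energy_integrable[OF assms] by simp
    show "\<bar>sqlog (u x)\<bar> \<le> C * \<bar>u x\<bar>" for x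
      using C[of "u x" 0] abs_le_mass[OF assms, of x] \<open>0 \<le> R\<close> by (simp add: R_def)
  qed
qed

text \<open>
  On the unit sphere \<open>u\<^sup>2 \<le> 1 / \<mu>\<^sub>0\<close> pointwise, so the logarithm is bounded above.  This bounds \<open>J\<close> from
  below there, and bounds the energy along minimising sequences.
\<close>

lemma entropy_le:
  assumes "finite_energy u" "mass u = 1" shows "entropy u \<le> ln (1 / \<mu>\<^sub>0)"
proof -
  have "entropy u \<le> (LINT x|M. ln (1 / \<mu>\<^sub>0) * (u x)\<^sup>2)"
    unfolding entropy_def
  proof (rule integral_mono)
    show "integrable M (\<lambda>x. sqlog (u x))"
      by (rule integrable_sqlog) fact
    show "integrable M (\<lambda>x. ln (1 / \<mu>\<^sub>0) * (u x)\<^sup>2)"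
      using finite_energy_integrable_square[OF assms(1)] by simp
    show "sqlog (u x) \<le> ln (1 / \<mu>\<^sub>0) * (u x)\<^sup>2" for x
    proof (cases "u x = 0")
      case False
      have "(u x)\<^sup>2 \<le> 1 / \<mu>\<^sub>0"
        using abs_le_mass[OF assms(1), of x] assms(2) \<mu>\<^sub>0_pos
        by (metis power2_abs real_sqrt_le_iff real_sqrt_abs)
      with False have "ln ((u x)\<^sup>2) \<le> ln (1 / \<mu>\<^sub>0)"
        by (intro ln_mono) auto
      then show ?thesis
        unfolding sqlog_def by (subst mult.commute) (intro mult_right_mono, auto)
    qed simp
  qed
  also have "\<dots> = ln (1 / \<mu>\<^sub>0)"
    using assms(2) by (simp add: mass_def)
  finally show ?thesis .
qed

lemma sqlog_scaled: "t \<noteq> 0 \<Longrightarrow> sqlog (t * s) = t\<^sup>2 * sqlog s + sqlog t * s\<^sup>2"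
  by (cases "s = 0") (simp_all add: sqlog_def power_mult_distrib ln_mult algebra_simps)

lemma mass_scaled: "mass (\<lambda>x. t * u x) = t\<^sup>2 * mass u"
  by (simp add: mass_def power_mult_distrib)

lemma entropy_scaled:
  assumes "finite_energy u" "t \<noteq> 0"
  shows "entropy (\<lambda>x. t * u x) = t\<^sup>2 * entropy u + sqlog t * mass u"
  unfolding entropy_def mass_def sqlog_scaled[OF assms(2)]
  using integrable_sqlog[OF assms(1)] finite_energy_integrable_square[OF assms(1)] by simp

lemma mass_eq_0:
  assumes "finite_energy u" "mass u = 0" shows "u = (\<lambda>x. 0)"
  using abs_le_mass[OF assms(1)] assms(2) by auto

text \<open>
  The infimum of \<open>2 J\<close>, rather than of \<open>J\<close>, on the unit sphere of \<open>L\<^sup>2\<close>: without the factor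
  \<open>1 / 2\<close> it becomes the additive shift of \<open>log t\<^sup>2\<close> under scaling.
\<close>

definition level :: real where
  "level = (INF u\<in>{u \<in> H. mass u = 1}. energy u - entropy u)"

lemma sphere_bdd_below: "bdd_below ((\<lambda>u. energy u - entropy u) ` {u \<in> H. mass u = 1})"
proof (rule bdd_belowI2)
  show "- ln (1 / \<mu>\<^sub>0) \<le> energy u - entropy u" if "u \<in> {u \<in> H. mass u = 1}" for u
    using entropy_le[of u] energy_nonneg[of u] that H_finite_energy by force
qed

lemma normalise:
  assumes "u \<in> H" "u \<noteq> (\<lambda>x. 0)"
  shows "0 < mass u" "(\<lambda>x. (1 / sqrt (mass u)) * u x) \<in> {u \<in> H. mass u = 1}"
proof -
  show "0 < mass u"
    using mass_eq_0[of u] mass_nonneg[of u] assms H_finite_energy by fastforce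
  then show "(\<lambda>x. (1 / sqrt (mass u)) * u x) \<in> {u \<in> H. mass u = 1}"
    using H_scaled[OF assms(1), of "1 / sqrt (mass u)"] mass_scaled[of "1 / sqrt (mass u)" u]
    by (simp add: power_divide)
qed

lemma sphere_nonempty: "{u \<in> H. mass u = 1} \<noteq> {}"
proof -
  fix z :: 'v
  define d :: "'v \<Rightarrow> real" where "d x = (if x = z then 1 else 0)" for x
  have "d \<in> Cc" by (simp add: Cc_def d_def)
  moreover have "d \<noteq> (\<lambda>x. 0)" by (auto simp: d_def fun_eq_iff)
  ultimately show ?thesis using normalise(2)[of d] Cc_subset_H by blast
qed

text \<open>
  The logarithmic Sobolev inequality obtained by scaling \<open>u\<close> to the unit sphere.  The last term is
  \<open>mass u * ln (mass u)\<close>, written through \<open>sqlog\<close> so that it is visibly continuous down to mass 0.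
\<close>

lemma level_le:
  assumes "u \<in> H"
  shows "level * mass u \<le> energy u - entropy u + sqlog (sqrt (mass u))"
proof (cases "u = (\<lambda>x. 0)")
  case True
  then show ?thesis by (simp add: mass_def entropy_def energy_def)
next
  case False
  note pos = normalise(1)[OF assms False]
  define t where "t = sqrt (mass u)"
  have t: "0 < t" "t\<^sup>2 = mass u" using pos by (auto simp: t_def)
  define w where "w = (\<lambda>x. (1 / t) * u x)"
  have w: "w \<in> {u \<in> H. mass u = 1}"
    using normalise(2)[OF assms False] by (simp add: w_def t_def)
  have u: "u = (\<lambda>x. t * w x)"
    using t(1) by (simp add: w_def)
  have "level \<le> energy w - entropy w"
    unfolding level_def by (rule cINF_lower[OF sphere_bdd_below w])
  then have "t\<^sup>2 * level \<le> t\<^sup>2 * (energy w - entropy w)"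
    by (rule mult_left_mono) simp
  moreover have "energy u = t\<^sup>2 * energy w"
    unfolding u by (rule energy_scaled)
  moreover have "entropy u = t\<^sup>2 * entropy w + sqlog t * mass w"
    unfolding u by (rule entropy_scaled) (use w t H_finite_energy in auto)
  ultimately show ?thesis
    using w t by (simp add: algebra_simps flip: t_def)
qed

lemma minimising_sequence:
  "\<exists>u. (\<forall>n. u n \<in> H \<and> mass (u n) = 1 \<and> energy (u n) - entropy (u n) \<le> level + 1)
    \<and> (\<lambda>n. energy (u n) - entropy (u n)) \<longlonglongrightarrow> level"
proof -
  have "\<exists>u. u \<in> {u \<in> H. mass u = 1} \<and> energy u - entropy u < level + inverse (Suc n)" for n
    using cINF_less_iff[OF sphere_nonempty sphere_bdd_below, of "level + inverse (Suc n)"]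
    unfolding level_def[symmetric] by auto
  then have "\<forall>n. \<exists>u. u \<in> {u \<in> H. mass u = 1} \<and> energy u - entropy u < level + inverse (Suc n)"
    by (rule allI)
  then obtain u where "\<forall>n. u n \<in> {u \<in> H. mass u = 1}
      \<and> energy (u n) - entropy (u n) < level + inverse (Suc n)"
    by (rule choice[THEN exE])
  then have u: "\<And>n. u n \<in> {u \<in> H. mass u = 1}"
      "\<And>n. energy (u n) - entropy (u n) < level + inverse (Suc n)"
    by blast+
  show ?thesis
  proof (intro exI[of _ u] conjI allI)
    show "u n \<in> H" "mass (u n) = 1" for n using u(1) by auto
    show "energy (u n) - entropy (u n) \<le> level + 1" for n
    proof -
      have "inverse (real (Suc n)) \<le> 1" by (simp add: field_simps)
      with u(2)[of n] show ?thesis by linarith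
    qed
    show "(\<lambda>n. energy (u n) - entropy (u n)) \<longlonglongrightarrow> level"
    proof (rule tendsto_sandwich[OF _ _ tendsto_const])
      show "\<forall>\<^sub>F n in sequentially. level \<le> energy (u n) - entropy (u n)"
        unfolding level_def by (intro always_eventually allI cINF_lower[OF sphere_bdd_below] u)
      show "\<forall>\<^sub>F n in sequentially. energy (u n) - entropy (u n) \<le> level + inverse (Suc n)"
        using u(2) by (intro always_eventually allI less_imp_le)
      show "(\<lambda>n. level + inverse (Suc n)) \<longlonglongrightarrow> level"
        using tendsto_add[OF tendsto_const LIMSEQ_inverse_real_of_nat] by simp
    qed
  qed
qed

section \<open>Existence of a minimiser on the unit sphere\<close>

definition average :: "('v \<Rightarrow> real) \<Rightarrow> ('v \<Rightarrow> real) \<Rightarrow> 'v \<Rightarrow> real" where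
  "average p q x = 1 / 2 * p x + 1 / 2 * q x"

lemma average_H: "p \<in> H \<Longrightarrow> q \<in> H \<Longrightarrow> average p q \<in> H"
  unfolding average_def[abs_def] by (intro H_add_scaled H_scaled)

lemma average_finite_energy: "finite_energy p \<Longrightarrow> finite_energy q \<Longrightarrow> finite_energy (average p q)"
  unfolding average_def[abs_def] by (intro finite_energy_add_scaled finite_energy_scaled)

lemma average_commute: "average p q = average q p"
  by (auto simp: average_def)

lemma parallelogram:
  assumes "finite_energy p" "finite_energy q"
  shows "energy (average p q) + 1 / 4 * energy (\<lambda>x. p x + (-1) * q x)
    = 1 / 2 * energy p + 1 / 2 * energy q"
proof -
  have "average p q = (\<lambda>x. (1 / 2) * (p x + 1 * q x))"
    by (auto simp: average_def)
  then have "energy (average p q) = 1 / 4 * energy (\<lambda>x. p x + 1 * q x)"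
    by (simp only: energy_scaled) (simp add: power_divide)
  then show ?thesis
    using energy_add_scaled[OF assms, of 1] energy_add_scaled[OF assms, of "-1"]
    by (simp add: algebra_simps)
qed

lemma tendsto_entropy_mass:
  assumes u: "\<And>n. finite_energy (u n)" "\<And>n x. \<bar>u n x\<bar> \<le> R" and v: "finite_energy v" "\<And>x. \<bar>v x\<bar> \<le> R"
    and lim: "(\<lambda>n. LINT x|M. \<bar>u n x - v x\<bar>) \<longlonglongrightarrow> 0"
  shows "(\<lambda>n. entropy (u n)) \<longlonglongrightarrow> entropy v" "(\<lambda>n. mass (u n)) \<longlonglongrightarrow> mass v"
proof -
  obtain C where C: "\<And>s t. \<bar>s\<bar> \<le> R \<Longrightarrow> \<bar>t\<bar> \<le> R \<Longrightarrow> \<bar>sqlog s - sqlog t\<bar> \<le> C * \<bar>s - t\<bar>"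
    using sqlog_lipschitz[of R] by blast
  show "(\<lambda>n. entropy (u n)) \<longlonglongrightarrow> entropy v"
    unfolding entropy_def by (rule tendsto_integral_lipschitz[OF u v lim C sqlog_0])
  show "(\<lambda>n. mass (u n)) \<longlonglongrightarrow> mass v"
    unfolding mass_def
    by (rule tendsto_integral_lipschitz[OF u v lim, where g = "\<lambda>t. t\<^sup>2"], rule square_lipschitz) auto
qed

lemma tendsto_avg:
  assumes u: "\<And>n. finite_energy (u n)" "\<And>n x. \<bar>u n x\<bar> \<le> R" and v: "finite_energy v" "\<And>x. \<bar>v x\<bar> \<le> R"
    and p: "finite_energy p" "\<And>x. \<bar>p x\<bar> \<le> R"
    and lim: "(\<lambda>n. LINT x|M. \<bar>u n x - v x\<bar>) \<longlonglongrightarrow> 0"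
  shows "(\<lambda>n. entropy (average p (u n))) \<longlonglongrightarrow> entropy (average p v)"
    "(\<lambda>n. mass (average p (u n))) \<longlonglongrightarrow> mass (average p v)"
proof -
  have bound: "\<bar>average p q x\<bar> \<le> R" if "\<And>x. \<bar>q x\<bar> \<le> R" for q x
    using p(2)[of x] that[of x] unfolding average_def by linarith
  have "\<bar>average p (u n) x - average p v x\<bar> = 1 / 2 * \<bar>u n x - v x\<bar>" for n x
    unfolding average_def by (auto simp: abs_if field_simps)
  then have "(LINT x|M. \<bar>average p (u n) x - average p v x\<bar>) = 1 / 2 * (LINT x|M. \<bar>u n x - v x\<bar>)" for n
    by (simp only: integral_mult_right_zero)
  then have "(\<lambda>n. LINT x|M. \<bar>average p (u n) x - average p v x\<bar>) \<longlonglongrightarrow> 0"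
    using tendsto_mult_left[OF lim, of "1 / 2"] by (simp only: mult_zero_right)
  note * = tendsto_entropy_mass[OF average_finite_energy[OF p(1) u(1)] bound[OF u(2)]
      average_finite_energy[OF p(1) v(1)] bound[OF v(2)] this]
  from * show "(\<lambda>n. entropy (average p (u n))) \<longlonglongrightarrow> entropy (average p v)"
    "(\<lambda>n. mass (average p (u n))) \<longlonglongrightarrow> mass (average p v)" by auto
qed

lemma isCont_sqlog: "isCont sqlog t"
  using sqlog_has_derivative by (rule DERIV_isCont)

text \<open>
  Let \<open>u n\<close> be a minimising sequence with pointwise limit \<open>v\<close>.  By the parallelogram identity, the energy
  of \<open>u n - u k\<close> is controlled by the energies of \<open>u n\<close> and \<open>u k\<close>, which converge to \<open>level + entropy v\<close>,
  minus that of their midpoint, which \<open>level_le\<close> bounds below by quantities continuous in \<open>L\<^sup>1\<close>.  Letting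
  \<open>k \<rightarrow> \<infinity>\<close> with Fatou's lemma bounds the energy of \<open>u n - v\<close>; these bounds tend to 0 as \<open>n \<rightarrow> \<infinity>\<close>,
  because the midpoints converge to \<open>v\<close> itself, where \<open>level + entropy v\<close> cancels.  Fatou's lemma alone
  would give \<open>energy v - entropy v \<le> level\<close>, but not \<open>v \<in> H\<close>.
\<close>

lemma minimiser_exists: "\<exists>v \<in> H. mass v = 1 \<and> energy v - entropy v = level"
proof -
  define R where "R = sqrt (1 / \<mu>\<^sub>0)"
  obtain u0 where u0: "\<And>n. u0 n \<in> H" "\<And>n. mass (u0 n) = 1"
    "\<And>n. energy (u0 n) - entropy (u0 n) \<le> level + 1" "(\<lambda>n. energy (u0 n) - entropy (u0 n)) \<longlonglongrightarrow> level"
    using minimising_sequence by blast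
  have R_u0: "norm (u0 n x) \<le> R" for n x
    using abs_le_mass[OF H_finite_energy[OF u0(1)], of n x] by (simp add: u0(2) R_def)
  have "\<exists>k::nat \<Rightarrow> nat. strict_mono k \<and> (\<forall>x. \<exists>l. (\<lambda>n. u0 (k n) x) \<longlonglongrightarrow> l)"
  proof (rule function_convergent_subsequence[OF countable_vertices R_u0])
    fix k :: "nat \<Rightarrow> nat"
    assume "strict_mono k" "\<And>x. x \<in> UNIV \<Longrightarrow> \<exists>l. (\<lambda>n. u0 (k n) x) \<longlonglongrightarrow> l"
    then show ?thesis by auto
  qed
  then obtain k where k: "strict_mono (k :: nat \<Rightarrow> nat)" and "\<forall>x. \<exists>l. (\<lambda>n. u0 (k n) x) \<longlonglongrightarrow> l"
    by blast
  then obtain v where lim: "(\<lambda>n. u0 (k n) x) \<longlonglongrightarrow> v x" for x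
    by metis
  define u where "u n = u0 (k n)" for n
  have uH: "u n \<in> H" and mass_u: "mass (u n) = 1" for n
    by (simp_all add: u_def u0)
  note fin_u = H_finite_energy[OF uH]
  have lim: "(\<lambda>n. u n x) \<longlonglongrightarrow> v x" for x
    using lim by (simp add: u_def)
  have level_lim: "(\<lambda>n. energy (u n) - entropy (u n)) \<longlonglongrightarrow> level"
    using LIMSEQ_subseq_LIMSEQ[OF u0(4) k] by (simp add: comp_def u_def)
  have energy_u: "energy (u n) \<le> level + 1 + ln (1 / \<mu>\<^sub>0)" for n
    using u0(3)[of "k n"] entropy_le[OF fin_u mass_u, of n] by (simp add: u_def)
  note L1 = L1_convergence[OF fin_u energy_u lim]
  have R_u: "\<bar>u n x\<bar> \<le> R" for n x
    using abs_le_mass[OF fin_u, of n x] by (simp add: mass_u R_def)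
  have R_v: "\<bar>v x\<bar> \<le> R" for x
    by (rule LIMSEQ_le_const2[OF tendsto_rabs[OF lim]]) (use R_u in auto)
  note entropy_mass = tendsto_entropy_mass[OF fin_u R_u L1(1) R_v L1(2)]
  have mass_v: "mass v = 1"
    using LIMSEQ_unique[OF entropy_mass(2)] by (simp add: mass_u)
  have energy_lim: "(\<lambda>n. energy (u n)) \<longlonglongrightarrow> level + entropy v"
    using tendsto_add[OF level_lim entropy_mass(1)] by simp
  have energy_diff: "energy (\<lambda>x. p x + (-1) * q x)
      \<le> 4 * (1 / 2 * energy p + 1 / 2 * energy q - level * mass (average p q) - entropy (average p q)
        + sqlog (sqrt (mass (average p q))))" if "p \<in> H" "q \<in> H" for p q
  proof -
    have "s \<le> 4 * t" if "1 / 4 * s \<le> t" for s t :: real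
      using that by simp
    then show ?thesis
      using parallelogram[OF that[THEN H_finite_energy]] level_le[OF average_H[OF that]] by force
  qed
  \<comment> \<open>Up to the factor 4, the limit for \<open>k \<rightarrow> \<infinity>\<close> of the bound on the energy of \<open>u n - u k\<close>.\<close>
  define c where "c n = 1 / 2 * energy (u n) + 1 / 2 * (level + entropy v)
      - level * mass (average (u n) v) - entropy (average (u n) v)
        + sqlog (sqrt (mass (average (u n) v)))" for n
  have energy_uv: "energy (\<lambda>x. u n x + (-1) * v x) \<le> 4 * c n" for n
  proof (rule energy_Fatou(2))
    show "finite_energy (\<lambda>x. u n x + (-1) * u k x)" for k
      by (intro finite_energy_add_scaled fin_u)
    show "(\<lambda>k. u n x + (-1) * u k x) \<longlonglongrightarrow> u n x + (-1) * v x" for x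
      by (intro tendsto_intros lim)
    show "energy (\<lambda>x. u n x + (-1) * u k x)
        \<le> 4 * (1 / 2 * energy (u n) + 1 / 2 * energy (u k) - level * mass (average (u n) (u k))
          - entropy (average (u n) (u k)) + sqlog (sqrt (mass (average (u n) (u k)))))" for k
      by (rule energy_diff[OF uH uH])
    note mid = tendsto_avg[OF fin_u R_u L1(1) R_v fin_u R_u L1(2)]
    show "(\<lambda>k. 4 * (1 / 2 * energy (u n) + 1 / 2 * energy (u k) - level * mass (average (u n) (u k))
          - entropy (average (u n) (u k)) + sqlog (sqrt (mass (average (u n) (u k)))))) \<longlonglongrightarrow> 4 * c n"
      unfolding c_def by (intro tendsto_intros energy_lim mid isCont_tendsto_compose[OF isCont_sqlog])
  qed
  have "average v (u n) = average (u n) v" for n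
    by (rule average_commute)
  note mid = tendsto_avg[OF fin_u R_u L1(1) R_v L1(1) R_v L1(2), unfolded this]
  have mid_v: "average v v = v"
    by (auto simp: average_def)
  have "(\<lambda>n. 4 * c n) \<longlonglongrightarrow> 4 * (1 / 2 * (level + entropy v) + 1 / 2 * (level + entropy v)
      - level * mass (average v v) - entropy (average v v) + sqlog (sqrt (mass (average v v))))"
    unfolding c_def
    by (intro tendsto_intros energy_lim mid isCont_tendsto_compose[OF isCont_sqlog])
  also have "4 * (1 / 2 * (level + entropy v) + 1 / 2 * (level + entropy v)
      - level * mass (average v v) - entropy (average v v) + sqlog (sqrt (mass (average v v)))) = 0"
    by (simp add: mid_v mass_v sqlog_def)
  finally have c_lim: "(\<lambda>n. 4 * c n) \<longlonglongrightarrow> 0" .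
  have "(\<lambda>n. energy (\<lambda>x. u n x + (-1) * v x)) \<longlonglongrightarrow> 0"
  proof (rule tendsto_sandwich[OF _ _ tendsto_const c_lim])
    show "\<forall>\<^sub>F n in sequentially. 0 \<le> energy (\<lambda>x. u n x + (-1) * v x)"
      by (intro always_eventually allI energy_nonneg)
    show "\<forall>\<^sub>F n in sequentially. energy (\<lambda>x. u n x + (-1) * v x) \<le> 4 * c n"
      by (intro always_eventually allI energy_uv)
  qed
  then have vH: "v \<in> H"
    by (rule H_closed[OF uH L1(1)])
  have "energy v \<le> level + entropy v"
    by (rule energy_Fatou(2)[OF fin_u order_refl energy_lim lim])
  moreover have "level \<le> energy v - entropy v"
    using level_le[OF vH] by (simp add: mass_v sqlog_def)
  ultimately have "energy v - entropy v = level" by linarith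
  with vH mass_v show ?thesis by blast
qed

section \<open>The equation satisfied by minimisers\<close>

lemma integrable_prod:
  assumes "finite_energy u" "finite_energy w" shows "integrable M (\<lambda>x. u x * w x)"
proof (rule integrable_le)
  show "integrable M (\<lambda>x. (u x)\<^sup>2 + (w x)\<^sup>2)"
    by (intro Bochner_Integration.integrable_add finite_energy_integrable_square assms)
  show "\<bar>u x * w x\<bar> \<le> (u x)\<^sup>2 + (w x)\<^sup>2" for x
    using sum_squares_bound[of "\<bar>u x\<bar>" "\<bar>w x\<bar>"] mult_nonneg_nonneg[of "\<bar>u x\<bar>" "\<bar>w x\<bar>"]
    unfolding abs_mult power2_abs by linarith
qed

lemma mass_add_scaled:
  assumes "finite_energy u" "finite_energy w"
  shows "mass (\<lambda>x. u x + s * w x) = mass u + 2 * s * (LINT x|M. u x * w x) + s\<^sup>2 * mass w"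
proof -
  have "(u x + s * w x)\<^sup>2 = (u x)\<^sup>2 + 2 * s * (u x * w x) + s\<^sup>2 * (w x)\<^sup>2" for x
    by (simp add: power2_eq_square algebra_simps)
  then show ?thesis
    unfolding mass_def
    using assms by (simp add: finite_energy_integrable_square integrable_prod)
qed

lemma integrable_sqlog_deriv:
  assumes "finite_energy u" "finite_energy w" shows "integrable M (\<lambda>x. sqlog_deriv (u x) * w x)"
proof -
  obtain C where C: "\<And>t. \<bar>t\<bar> \<le> sqrt (mass u / \<mu>\<^sub>0) \<Longrightarrow> \<bar>sqlog_deriv t\<bar> \<le> C"
    using sqlog_deriv_bounded[of "sqrt (mass u / \<mu>\<^sub>0)"] by blast
  show ?thesis
  proof (rule integrable_le)
    show "integrable M (\<lambda>x. C * \<bar>w x\<bar>)"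
      using finite_energy_integrable[OF assms(2)] by simp
    show "\<bar>sqlog_deriv (u x) * w x\<bar> \<le> C * \<bar>w x\<bar>" for x
      unfolding abs_mult by (intro mult_right_mono C abs_le_mass assms) simp
  qed
qed

text \<open>
  Differentiation under the integral: \<open>w\<close> itself is integrable, and by the Lipschitz bound the
  difference quotients are dominated by a multiple of \<open>\<bar>w\<bar>\<close>.
\<close>

lemma entropy_has_derivative:
  assumes u: "finite_energy u" and w: "finite_energy w"
  shows "((\<lambda>s. entropy (\<lambda>x. u x + s * w x)) has_real_derivative
    (LINT x|M. sqlog_deriv (u x) * w x)) (at 0)"
proof -
  define R where "R = sqrt (mass u / \<mu>\<^sub>0) + sqrt (mass w / \<mu>\<^sub>0)"
  have R: "\<bar>u x + s * w x\<bar> \<le> R" if "\<bar>s\<bar> \<le> 1" for s x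
  proof -
    have "\<bar>u x + s * w x\<bar> \<le> \<bar>u x\<bar> + \<bar>s\<bar> * \<bar>w x\<bar>"
      using abs_triangle_ineq[of "u x" "s * w x"] by (simp add: abs_mult)
    also have "\<bar>s\<bar> * \<bar>w x\<bar> \<le> 1 * \<bar>w x\<bar>"
      using that by (intro mult_right_mono) auto
    finally show ?thesis
      using abs_le_mass[OF u, of x] abs_le_mass[OF w, of x] by (simp add: R_def)
  qed
  obtain C where C: "\<And>s t. \<bar>s\<bar> \<le> R \<Longrightarrow> \<bar>t\<bar> \<le> R \<Longrightarrow> \<bar>sqlog s - sqlog t\<bar> \<le> C * \<bar>s - t\<bar>"
    using sqlog_lipschitz[of R] by blast
  define q where "q s x = (sqlog (u x + s * w x) - sqlog (u x)) / s" for s x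
  have "((\<lambda>s. integral\<^sup>L M (q s)) \<longlongrightarrow> (LINT x|M. sqlog_deriv (u x) * w x)) (at 0 within {-1..1})"
    unfolding tendsto_at_iff_sequentially
  proof (intro allI impI)
    fix X :: "nat \<Rightarrow> real"
    assume X: "\<forall>i. X i \<in> {-1..1} - {0}" and X0: "X \<longlonglongrightarrow> 0"
    have "(\<lambda>i. integral\<^sup>L M (q (X i))) \<longlonglongrightarrow> (LINT x|M. sqlog_deriv (u x) * w x)"
    proof (rule integral_dominated_convergence)
      show "integrable M (\<lambda>x. C * \<bar>w x\<bar>)"
        using finite_energy_integrable[OF w] by simp
      have "(\<lambda>i. q (X i) x) \<longlonglongrightarrow> sqlog_deriv (u x) * w x" for x
      proof -
        have "((\<lambda>s. sqlog (u x + s * w x)) has_real_derivative sqlog_deriv (u x + 0 * w x) * w x) (at 0)"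
          by (rule DERIV_chain2[OF sqlog_has_derivative]) (auto intro!: derivative_eq_intros)
        then have "((\<lambda>s. q s x) \<longlongrightarrow> sqlog_deriv (u x) * w x) (at 0)"
          by (simp add: has_field_derivative_iff q_def)
        moreover have "filterlim X (at 0) sequentially"
          using X X0 by (auto simp: filterlim_at)
        ultimately show ?thesis by (rule filterlim_compose)
      qed
      then show "AE x in M. (\<lambda>i. q (X i) x) \<longlonglongrightarrow> sqlog_deriv (u x) * w x" by simp
      have "\<bar>q (X i) x\<bar> \<le> C * \<bar>w x\<bar>" for i x
      proof -
        have Xi: "\<bar>X i\<bar> \<le> 1" "X i \<noteq> 0" using X by (auto simp: abs_le_iff)
        have "\<bar>sqlog (u x + X i * w x) - sqlog (u x)\<bar> \<le> C * \<bar>(u x + X i * w x) - u x\<bar>"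
          using R[OF Xi(1), of x] R[of 0 x] by (intro C) auto
        then show ?thesis
          using Xi by (simp add: q_def abs_mult field_simps)
      qed
      then show "AE x in M. norm (q (X i) x) \<le> C * \<bar>w x\<bar>" for i by simp
    qed auto
    then show "((\<lambda>s. integral\<^sup>L M (q s)) \<circ> X) \<longlonglongrightarrow> (LINT x|M. sqlog_deriv (u x) * w x)"
      by (simp add: comp_def)
  qed
  then have "((\<lambda>s. integral\<^sup>L M (q s)) \<longlongrightarrow> (LINT x|M. sqlog_deriv (u x) * w x)) (at 0)"
    by (simp add: at_within_Icc_at)
  moreover have "integral\<^sup>L M (q s) = (entropy (\<lambda>x. u x + s * w x) - entropy u) / s" for s
    unfolding q_def entropy_def
    using integrable_sqlog[OF finite_energy_add_scaled[OF u w, of s]] integrable_sqlog[OF u] by simp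
  ultimately show ?thesis
    by (simp add: has_field_derivative_iff)
qed

text \<open>
  The right-hand side of \<open>level_le\<close> minus its left-hand side is nonnegative and vanishes at \<open>u\<close>; hence
  its derivative along every direction \<open>w\<close> is zero.  The extra multiple of \<open>u\<close> collects the derivative
  of \<open>r * ln r\<close> at \<open>r = 1\<close> and the term with \<open>level\<close>.
\<close>

lemma euler_lagrange:
  assumes u: "u \<in> H" "mass u = 1" "energy u - entropy u = level" and w: "w \<in> H"
  shows "(LINT x|M. energy_density E \<omega> \<mu> b u w x)
    = 1 / 2 * (LINT x|M. sqlog_deriv (u x) * w x) + (level - 1) * (LINT x|M. u x * w x)"
proof -
  note fin = H_finite_energy[OF u(1)] H_finite_energy[OF w]
  define B I where "B = (LINT x|M. energy_density E \<omega> \<mu> b u w x)" and "I = (LINT x|M. u x * w x)"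
  define mass_along where "mass_along s = mass u + 2 * s * I + s\<^sup>2 * mass w" for s
  \<comment> \<open>The two sides of \<open>level_le\<close> at \<open>u + s w\<close>, with energy and mass expanded in \<open>s\<close>.\<close>
  define gap where "gap s = (energy u + 2 * s * B + s\<^sup>2 * energy w) - entropy (\<lambda>x. u x + s * w x)
    + mass_along s * ln (mass_along s) - level * mass_along s" for s
  have gap: "gap 0 \<le> gap s" for s
  proof -
    define y where "y = (\<lambda>x. u x + s * w x)"
    have "mass y = mass_along s"
      unfolding y_def mass_along_def I_def by (rule mass_add_scaled[OF fin])
    moreover have "energy y = energy u + 2 * s * B + s\<^sup>2 * energy w"
      unfolding y_def B_def by (rule energy_add_scaled[OF fin])
    moreover have "level * mass y \<le> energy y - entropy y + sqlog (sqrt (mass y))"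
      unfolding y_def by (intro level_le H_add_scaled u w)
    moreover have "sqlog (sqrt (mass y)) = mass y * ln (mass y)"
      using mass_nonneg[of y] by (simp add: sqlog_def)
    ultimately have "0 \<le> gap s" by (simp add: gap_def flip: y_def)
    moreover have "gap 0 = 0" using u by (simp add: gap_def mass_along_def)
    ultimately show ?thesis by simp
  qed
  have mass_along: "(mass_along has_real_derivative 2 * I) (at 0)"
    unfolding mass_along_def[abs_def] by (auto intro!: derivative_eq_intros)
  have "mass_along 0 = 1" by (simp add: mass_along_def u)
  then have "(gap has_real_derivative
      2 * B - (LINT x|M. sqlog_deriv (u x) * w x) + 2 * I - level * (2 * I)) (at 0)"
    unfolding gap_def[abs_def]
    by (auto intro!: derivative_eq_intros mass_along entropy_has_derivative fin)
  from DERIV_local_min[OF this, of 1] gap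
  have "2 * B - (LINT x|M. sqlog_deriv (u x) * w x) + 2 * I - level * (2 * I) = 0" by simp
  then show ?thesis
    unfolding B_def[symmetric] I_def[symmetric] by (simp add: algebra_simps)
qed

lemma Gam_scaled_left: "Gam E \<omega> \<mu> (\<lambda>x. t * u x) v x = t * Gam E \<omega> \<mu> u v x"
proof -
  have "(\<Sum>y\<in>E `` {x}. \<omega> x y * (t * u y - t * u x) * (v y - v x))
      = t * (\<Sum>y\<in>E `` {x}. \<omega> x y * (u y - u x) * (v y - v x))"
    unfolding sum_distrib_left by (intro sum.cong) (auto simp: algebra_simps)
  then show ?thesis by (simp add: Gam_def)
qed

text \<open>
  As \<open>ln (t\<^sup>2) = level - 1\<close>, replacing \<open>u\<close> by \<open>t u\<close> adds \<open>(level - 1) u\<close> to \<open>u log u\<^sup>2\<close>, which is the extra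
  term of the Euler-Lagrange equation.
\<close>

lemma weak_solution_of_minimiser:
  assumes u: "u \<in> H" "mass u = 1" "energy u - entropy u = level"
  defines "t \<equiv> exp ((level - 1) / 2)"
  shows "weak_solution E \<omega> \<mu> a (\<lambda>x. t * u x)"
  unfolding weak_solution_def
proof (intro conjI ballI)
  show "(\<lambda>x. t * u x) \<in> H" by (intro H_scaled u)
next
  fix v assume v: "v \<in> H"
  note fin = H_finite_energy[OF u(1)] H_finite_energy[OF v]
  have t: "0 < t" by (simp add: t_def)
  have lnt: "ln (t\<^sup>2) = level - 1"
    unfolding t_def by (simp flip: exp_double)
  have int: "integrable M (energy_density E \<omega> \<mu> b u v)"
    using integrable_energy_density[of b u v] fin b_pos by (auto simp: finite_energy_def less_imp_le)
  have left: "Gam E \<omega> \<mu> (\<lambda>x. t * u x) v x + a x * (t * u x) * v x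
      = t * (energy_density E \<omega> \<mu> b u v x - u x * v x)" for x
    unfolding Gam_scaled_left energy_density_def by (simp add: algebra_simps)
  have right: "(t * u x) * v x * ln ((t * u x)\<^sup>2)
      = t * (1 / 2 * (sqlog_deriv (u x) * v x) - u x * v x + (level - 1) * (u x * v x))" for x
  proof (cases "u x = 0")
    case False
    have ln_eq: "ln ((t * u x)\<^sup>2) = level - 1 + ln ((u x)\<^sup>2)"
      using t False by (simp add: power_mult_distrib ln_mult lnt)
    show ?thesis unfolding ln_eq by (simp add: sqlog_deriv_def algebra_simps)
  qed (simp add: sqlog_deriv_def)
  show "(LINT x|M. Gam E \<omega> \<mu> (\<lambda>x. t * u x) v x + a x * (t * u x) * v x)
      = (LINT x|M. (t * u x) * v x * ln ((t * u x)\<^sup>2))"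
    unfolding left right
    using euler_lagrange[OF u v] int integrable_prod[OF fin] integrable_sqlog_deriv[OF fin] by simp
qed

section \<open>Ground states\<close>

text \<open>
  Testing the equation with \<open>w\<close> itself gives \<open>\<integral> (|\<nabla>w|\<^sup>2 + a w\<^sup>2) d\<mu> = entropy w\<close>, and the energy exceeds
  the left-hand side by the mass.
\<close>

lemma nehari:
  assumes "weak_solution E \<omega> \<mu> a w"
  shows "energy w - entropy w = mass w"
proof -
  have w: "finite_energy w" using assms by (simp add: weak_solution_def H_finite_energy)
  have "(LINT x|M. energy_density E \<omega> \<mu> b w w x - (w x)\<^sup>2) = entropy w"
    using assms unfolding weak_solution_def entropy_def
    by (auto simp: energy_density_def sqlog_def power2_eq_square algebra_simps)
  moreover have "(LINT x|M. energy_density E \<omega> \<mu> b w w x - (w x)\<^sup>2) = energy w - mass w"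
    using w finite_energy_integrable_square[OF w] unfolding energy_def mass_def finite_energy_def by simp
  ultimately show ?thesis by simp
qed

lemma weak_solution_mass_ge:
  assumes w: "weak_solution E \<omega> \<mu> a w" "w \<noteq> (\<lambda>x. 0)"
  shows "exp (level - 1) \<le> mass w"
proof -
  have H: "w \<in> H" using w by (simp add: weak_solution_def)
  have pos: "0 < mass w" by (rule normalise[OF H w(2)])
  have "level * mass w \<le> mass w + mass w * ln (mass w)"
    using level_le[OF H] nehari[OF w(1)] pos by (simp add: sqlog_def)
  then have "mass w * (level - 1) \<le> mass w * ln (mass w)"
    by (simp add: algebra_simps)
  then have "level - 1 \<le> ln (mass w)"
    using pos by simp
  then show ?thesis
    using pos by (simp add: ln_ge_iff)
qed

lemma ground_state_exists: "\<exists>u. ground_state_solution E \<omega> \<mu> a u"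
proof -
  obtain v where v: "v \<in> H" "mass v = 1" "energy v - entropy v = level"
    using minimiser_exists by blast
  define u where "u = (\<lambda>x. exp ((level - 1) / 2) * v x)"
  have weak: "weak_solution E \<omega> \<mu> a u"
    unfolding u_def by (rule weak_solution_of_minimiser[OF v])
  have mass: "mass u = exp (level - 1)"
    unfolding u_def mass_scaled using v(2) by (simp flip: exp_double)
  then have "u \<noteq> (\<lambda>x. 0)" by (auto simp: mass_def)
  moreover have "J E \<omega> \<mu> a u \<le> J E \<omega> \<mu> a w" if "weak_solution E \<omega> \<mu> a w" "w \<noteq> (\<lambda>x. 0)" for w
    unfolding J_eq nehari[OF weak] nehari[OF that(1)] mass
    using weak_solution_mass_ge[OF that] by simp
  ultimately show ?thesis
    using weak unfolding ground_state_solution_def by blast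
qed

end

theorem theorem2:
  fixes E :: "('v \<times> 'v) set"
    and \<omega> :: "'v \<Rightarrow> 'v \<Rightarrow> real"
    and \<mu> a :: "'v \<Rightarrow> real"
    and \<mu>\<^sub>m\<^sub>i\<^sub>n a\<^sub>0 M\<^sub>0 :: real
  assumes "locally_finite_graph E" and "connected_graph E"
    and "\<And>x y. (x, y) \<in> E \<Longrightarrow> \<omega> x y = \<omega> y x \<and> \<omega> x y > 0"
    and "\<mu>\<^sub>m\<^sub>i\<^sub>n > 0" and "\<And>x. \<mu> x \<ge> \<mu>\<^sub>m\<^sub>i\<^sub>n"
    and A1: "-1 < a\<^sub>0" "a\<^sub>0 < 0" "\<And>x. a x \<ge> a\<^sub>0"
    and A2': "M\<^sub>0 > 0"
      "set_integrable (vertex_measure \<mu>) (UNIV - {x. a x \<le> M\<^sub>0}) (\<lambda>x. 1 / a x)"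
      "emeasure (vertex_measure \<mu>) {x. a x \<le> M\<^sub>0} < \<infinity>"
  shows "\<exists>u. ground_state_solution E \<omega> \<mu> a u"
proof -
  let ?M = "vertex_measure \<mu>"
  have sets: "A \<in> sets ?M" for A
    by (simp add: vertex_measure_def point_measure_def)
  have meas: "f \<in> borel_measurable ?M" for f :: "'v \<Rightarrow> real"
    by (simp add: vertex_measure_def point_measure_def)
  \<comment> \<open>\<open>1 / (a + 1)\<close> is at most \<open>1 / (a\<^sub>0 + 1)\<close> on the sublevel set of finite volume, and at
    most \<open>1 / a\<close> outside it.\<close>
  have "integrable ?M (\<lambda>x. 1 / (a\<^sub>0 + 1) * indicator {x. a x \<le> M\<^sub>0} x
      + indicator (UNIV - {x. a x \<le> M\<^sub>0}) x *\<^sub>R (1 / a x))"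
    using A2'(2,3) unfolding set_integrable_def
    by (intro Bochner_Integration.integrable_add integrable_mult_right integrable_real_indicator sets) auto
  then have "integrable ?M (\<lambda>x. 1 / (a x + 1))"
  proof (rule Bochner_Integration.integrable_bound[OF _ meas])
    have "\<bar>1 / (a x + 1)\<bar> \<le> \<bar>1 / (a\<^sub>0 + 1)\<bar>" for x
      using A1(1) A1(3)[of x] by (auto simp: field_simps)
    moreover have "\<bar>1 / (a x + 1)\<bar> \<le> \<bar>1 / a x\<bar>" if "\<not> a x \<le> M\<^sub>0" for x
      using A2'(1) that by (auto simp: field_simps)
    ultimately show "AE x in ?M. norm (1 / (a x + 1)) \<le> norm (1 / (a\<^sub>0 + 1) * indicator {x. a x \<le> M\<^sub>0} x
      + indicator (UNIV - {x. a x \<le> M\<^sub>0}) x *\<^sub>R (1 / a x))"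
      by (intro AE_I2) (simp add: indicator_def)
  qed
  then interpret log_schrodinger E \<omega> \<mu> a \<mu>\<^sub>m\<^sub>i\<^sub>n a\<^sub>0
    using assms by unfold_locales (auto simp: locally_finite_graph_def less_imp_le)
  show ?thesis by (rule ground_state_exists)
qed

end
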